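(* Let $P=(p_1,\ldots,p_5)$ be a labeled pentagon in $\mathbb{RP}^2$ in the domain of Glick's operator $L_P$, and put $G_P=L_P-3I$. For arbitrary nonzero homogeneous lifts $\widetilde p_i\in\mathbb{R}^3$ put $[ijk]=\det(\widetilde p_i,\widetilde p_j,\widetilde p_k)$. Then $$\kappa(P)=\frac{[235][315][425][124][134]}{[415][125][345][123][234]}$$ is well defined, independent of the lifts, and invariant under projective transformations and cyclic relabelling. Moreover $\kappa(P)=-\det(G_P)$ and the characteristic polynomial of $G_P$ is $$\chi_{G_P}(t)=\det(tI-G_P)=t^3-t^2+\kappa(P)t+\kappa(P).$$ Thus $\kappa(P)$ completely determines the characteristic polynomial and the spectrum of $G_P$. With $\widehat L_P=L_P-\frac{10}{3}I$, $\mathcal S_5(P)=\frac12\operatorname{tr}(\widehat L_P^2)$ and $\mathcal R_5(P)=\det(\widehat L_P)$, one has $$\mathcal S_5(P)=\tfrac13-\kappa(P),\qquad \mathcal R_5(P)=\tfrac{2}{27}-\tfrac43\kappa(P),$$ so that $\mathcal R_5=\frac43\mathcal S_5-\frac{10}{27}$. Write $\kappa=\kappa(P)$ and $\kappa_\pm=\frac{-11\pm5\sqrt5}{2}$. The spectral type of $G_P$ is as follows: - $\kappa<\kappa_-$: three real eigenvalues with distinct moduli; - $\kappa=\kappa_-$: one simple and one double real eigenvalue; - $\kappa_-<\kappa<0$: one (strictly) dominant real eigenvalue and a non-real conjugate pair; - $\kappa=0$: $\operatorname{Spec}(G_P)=\{1,0,0\}$; - $0<\kappa<\kappa_+$: three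 real eigenvalues with distinct moduli; - $\kappa=\kappa_+$: one simple and one double real eigenvalue; - $\kappa>\kappa_+$: a (strictly) dominant non-real conjugate pair and one real eigenvalue. At the two repeated-spectrum values, with $\varphi=(1+\sqrt5)/2$, $\operatorname{Spec}(G_P)=\{2+\sqrt5,-\varphi,-\varphi\}$ for $\kappa=\kappa_-$ and $\operatorname{Spec}(G_P)=\{2-\sqrt5,\varphi^{-1},\varphi^{-1}\}$ for $\kappa=\kappa_+$. If $P$ is a strictly convex pentagon in $\mathbb{R}^2$ labeled in cyclic order, then $\kappa(P)\le\kappa_-$, with equality if and only if $P$ is projectively equivalent, with its cyclic labeling, to a regular pentagon. Consequently, every strictly convex pentagon (labeled in cyclic order) has real spectrum of $G_P$, and outside the projectively regular class its eigenvalues have pairwise distinct moduli.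
   Context: Glick's operator: for a labeled projective $n$-gon $P=(p_1,\dots,p_n)$ (indices modulo $n$) such that every consecutive triple $p_{i-1},p_i,p_{i+1}$ is noncollinear (this is the "domain of Glick's operator"), choose nonzero homogeneous lifts $\widetilde p_i\in\mathbb{R}^3$ and set, for $v\in\mathbb{R}^3$, $$L_P(v)=nv-\sum_{j=1}^n\frac{\det(\widetilde p_{j-1},v,\widetilde p_{j+1})}{\det(\widetilde p_{j-1},\widetilde p_j,\widetilde p_{j+1})}\,\widetilde p_j .$$ This linear operator on $\mathbb{R}^3$ does not depend on the lifts. Points of $\mathbb{R}^2$ are regarded as points of $\mathbb{RP}^2$ via $x\mapsto[x:1]$. Cyclic relabelling: $\Sigma_s(P)_i=p_{i+s}$. "Dominant" means of larger modulus. A pentagon is projectively regular (with its cyclic labeling) if a projective transformation carries it, vertex by vertex, to the regular convex pentagon $\bigl((\cos\frac{2\pi j}{5},\sin\frac{2\pi j}{5})\bigr)_{j=0}^{4}$ labeled in cyclic order. Spectra are listed with multiplicity. *)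

theory Defs
  imports "HOL-Analysis.Analysis" "HOL-Computational_Algebra.Polynomial"
begin

section \<open>The real projective plane\<close>

definition proportional :: "real^3 \<Rightarrow> real^3 \<Rightarrow> bool" where
  "proportional u v \<longleftrightarrow> u \<noteq> 0 \<and> v \<noteq> 0 \<and> (\<exists>c. c \<noteq> 0 \<and> v = c *\<^sub>R u)"

lemma part_equivp_proportional: "part_equivp proportional"
proof (rule part_equivpI)
  have "(axis 1 1 :: real^3) \<noteq> 0"
    by (simp add: axis_eq_0_iff)
  then show "\<exists>x. proportional x x"
    unfolding proportional_def by (intro exI[of _ "axis 1 1"]) (auto intro: exI[of _ 1])
  show "symp proportional"
  proof (rule sympI)
    fix u v assume "proportional u v"
    then obtain c where "u \<noteq> 0" "v \<noteq> 0" "c \<noteq> 0" "v = c *\<^sub>R u"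
      by (auto simp: proportional_def)
    then show "proportional v u"
      unfolding proportional_def by (intro conjI exI[of _ "inverse c"]) auto
  qed
  show "transp proportional"
  proof (rule transpI)
    fix u v w assume "proportional u v" "proportional v w"
    then obtain c d where "u \<noteq> 0" "v \<noteq> 0" "w \<noteq> 0" "c \<noteq> 0" "d \<noteq> 0" "v = c *\<^sub>R u" "w = d *\<^sub>R v"
      by (auto simp: proportional_def)
    then show "proportional u w"
      unfolding proportional_def by (intro conjI exI[of _ "d * c"]) auto
  qed
qed

text \<open>The quotient is partial because the zero vector is excluded; the value of
  \<open>proj_pt\<close> at \<open>0\<close> is meaningless.\<close>

quotient_type rp2 = "real^3" / partial: proportional
  morphisms rep_rp2 proj_pt
  by (rule part_equivp_proportional)

definition affine_pt :: "real^2 \<Rightarrow> rp2" where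
  "affine_pt x = proj_pt (vector [x $ 1, x $ 2, 1])"

definition proj_line :: "real^3 \<Rightarrow> rp2 set" where
  "proj_line l = proj_pt ` {v. v \<noteq> 0 \<and> l \<bullet> v = 0}"

definition proj_collinear :: "rp2 set \<Rightarrow> bool" where
  "proj_collinear S \<longleftrightarrow> (\<exists>l. l \<noteq> 0 \<and> S \<subseteq> proj_line l)"

definition projective_transformation :: "(rp2 \<Rightarrow> rp2) \<Rightarrow> bool" where
  "projective_transformation f \<longleftrightarrow>
     (\<exists>M :: real^3^3. invertible M \<and> (\<forall>v. v \<noteq> 0 \<longrightarrow> f (proj_pt v) = proj_pt (M *v v)))"


section \<open>Polygons and Glick's operator\<close>

text \<open>A labeled \<open>n\<close>-gon is a function on the indices modulo \<open>n\<close>, rendered by the numeral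
  type \<open>n\<close> (the ring of integers modulo \<open>n\<close>). For \<open>n = 5\<close> the index \<open>5\<close> is the same as \<open>0\<close>.
  The sort constraint below is only there to provide \<open>j - 1\<close> and \<open>j + 1\<close>; the definitions
  have their intended meaning at the numeral types.\<close>

definition homogeneous_lift :: "('n \<Rightarrow> real^3) \<Rightarrow> ('n \<Rightarrow> rp2) \<Rightarrow> bool" where
  "homogeneous_lift q P \<longleftrightarrow> (\<forall>i. q i \<noteq> 0 \<and> proj_pt (q i) = P i)"

definition some_lift :: "('n \<Rightarrow> rp2) \<Rightarrow> 'n \<Rightarrow> real^3" where
  "some_lift P = (SOME q. homogeneous_lift q P)"

definition glick_domain :: "('n::{finite,comm_ring_1} \<Rightarrow> rp2) \<Rightarrow> bool" where
  "glick_domain P \<longleftrightarrow> (\<forall>i. \<not> proj_collinear {P (i - 1), P i, P (i + 1)})"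

definition det3 :: "real^3 \<Rightarrow> real^3 \<Rightarrow> real^3 \<Rightarrow> real" where
  "det3 u v w = det (vector [u, v, w] :: real^3^3)"

definition glick_of_lift :: "('n::{finite,comm_ring_1} \<Rightarrow> real^3) \<Rightarrow> real^3 \<Rightarrow> real^3" where
  "glick_of_lift q v = real CARD('n) *\<^sub>R v -
     (\<Sum>j\<in>UNIV. (det3 (q (j - 1)) v (q (j + 1)) / det3 (q (j - 1)) (q j) (q (j + 1))) *\<^sub>R q j)"

text \<open>The choice of lifts is immaterial, see \<open>glick_eq_glick_of_lift\<close> below.\<close>

definition glick :: "('n::{finite,comm_ring_1} \<Rightarrow> rp2) \<Rightarrow> real^3 \<Rightarrow> real^3" where
  "glick P = glick_of_lift (some_lift P)"

definition relabel :: "'n::{finite,comm_ring_1} \<Rightarrow> ('n \<Rightarrow> rp2) \<Rightarrow> 'n \<Rightarrow> rp2" where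
  "relabel s P = (\<lambda>i. P (i + s))"


section \<open>Pentagons\<close>

definition G_op :: "(5 \<Rightarrow> rp2) \<Rightarrow> real^3 \<Rightarrow> real^3" where
  "G_op P v = glick P v - 3 *\<^sub>R v"

definition L_hat :: "(5 \<Rightarrow> rp2) \<Rightarrow> real^3 \<Rightarrow> real^3" where
  "L_hat P v = glick P v - (10/3) *\<^sub>R v"

definition S5 :: "(5 \<Rightarrow> rp2) \<Rightarrow> real" where
  "S5 P = 1/2 * trace (matrix (L_hat P \<circ> L_hat P))"

definition R5 :: "(5 \<Rightarrow> rp2) \<Rightarrow> real" where
  "R5 P = det (matrix (L_hat P))"

definition bracket :: "(5 \<Rightarrow> real^3) \<Rightarrow> 5 \<Rightarrow> 5 \<Rightarrow> 5 \<Rightarrow> real" where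
  "bracket q i j k = det3 (q i) (q j) (q k)"

definition kappa_num :: "(5 \<Rightarrow> real^3) \<Rightarrow> real" where
  "kappa_num q =
     bracket q 2 3 5 * bracket q 3 1 5 * bracket q 4 2 5 * bracket q 1 2 4 * bracket q 1 3 4"

definition kappa_den :: "(5 \<Rightarrow> real^3) \<Rightarrow> real" where
  "kappa_den q =
     bracket q 4 1 5 * bracket q 1 2 5 * bracket q 3 4 5 * bracket q 1 2 3 * bracket q 2 3 4"

definition kappa :: "(5 \<Rightarrow> rp2) \<Rightarrow> real" where
  "kappa P = kappa_num (some_lift P) / kappa_den (some_lift P)"

definition kappa_minus :: real where
  "kappa_minus = (- 11 - 5 * sqrt 5) / 2"

definition kappa_plus :: real where
  "kappa_plus = (- 11 + 5 * sqrt 5) / 2"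

definition golden :: real where
  "golden = (1 + sqrt 5) / 2"

definition regular_vertex :: "nat \<Rightarrow> real^2" where
  "regular_vertex j = vector [cos (2 * pi * real j / 5), sin (2 * pi * real j / 5)]"

text \<open>The vertices \<open>p\<^sub>1, \<dots>, p\<^sub>5\<close> go to the regular vertices numbered \<open>0, \<dots>, 4\<close>.\<close>

definition projectively_regular :: "(5 \<Rightarrow> rp2) \<Rightarrow> bool" where
  "projectively_regular P \<longleftrightarrow>
     (\<exists>f. projective_transformation f \<and>
          (\<forall>j<5. f (P (of_nat j + 1)) = affine_pt (regular_vertex j)))"

text \<open>The five points are the vertices of their convex hull, and consecutive labels span its
  edges; the latter excludes, for instance, the pentagram labeling.\<close>

definition strictly_convex_pentagon :: "(5 \<Rightarrow> real^2) \<Rightarrow> bool" where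
  "strictly_convex_pentagon x \<longleftrightarrow>
     inj x \<and>
     (\<forall>i. x i extreme_point_of (convex hull (range x))) \<and>
     (\<forall>i. closed_segment (x i) (x (i + 1)) edge_of (convex hull (range x)))"


section \<open>Characteristic polynomial and spectrum\<close>

definition charpoly :: "'a::comm_ring_1^'n^'n \<Rightarrow> 'a poly" where
  "charpoly A = det (mat [:0, 1:] - (\<chi> i j. [:A $ i $ j:]))"

text \<open>Complex eigenvalues, with algebraic multiplicity.\<close>

definition spectrum :: "real^'n^'n \<Rightarrow> complex multiset" where
  "spectrum A = proots (map_poly complex_of_real (charpoly A))"


section \<open>Independence of the lifts\<close>

lemma proj_pt_eq_iff:
  assumes "u \<noteq> 0" "v \<noteq> 0"
  shows "proj_pt u = proj_pt v \<longleftrightarrow> (\<exists>c. c \<noteq> 0 \<and> v = c *\<^sub>R u)"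
proof -
  have refl: "proportional w w" if "w \<noteq> 0" for w
    using that unfolding proportional_def by (auto intro: exI[of _ 1])
  have "proj_pt u = proj_pt v \<longleftrightarrow> proportional u v"
    using Quotient3_rel[OF Quotient3_rp2, of u v] refl assms by simp
  then show ?thesis
    using assms by (simp add: proportional_def)
qed

lemma ex_homogeneous_lift: "\<exists>q. homogeneous_lift q P"
proof -
  have "\<exists>v. v \<noteq> 0 \<and> proj_pt v = p" for p
    using Quotient3_rep_reflp[OF Quotient3_rp2, of p] Quotient3_abs_rep[OF Quotient3_rp2, of p]
    by (auto simp: proportional_def)
  then show ?thesis
    unfolding homogeneous_lift_def by (intro choice allI)
qed

lemma homogeneous_lift_some_lift: "homogeneous_lift (some_lift P) P"
  unfolding some_lift_def using ex_homogeneous_lift by (rule someI_ex)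

lemma homogeneous_lift_scale:
  assumes "homogeneous_lift q P" "homogeneous_lift q' P"
  obtains c where "\<And>i. c i \<noteq> 0" "\<And>i. q' i = c i *\<^sub>R q i"
proof -
  have "\<exists>c. c \<noteq> 0 \<and> q' i = c *\<^sub>R q i" for i
    using assms proj_pt_eq_iff[of "q i" "q' i"] by (auto simp: homogeneous_lift_def)
  then show ?thesis
    using that by metis
qed

lemma det3_expand:
  "det3 u v w = u$1 * (v$2 * w$3 - v$3 * w$2) - u$2 * (v$1 * w$3 - v$3 * w$1)
     + u$3 * (v$1 * w$2 - v$2 * w$1)"
  by (simp add: det3_def det_3 algebra_simps)

lemma det3_scale: "det3 (a *\<^sub>R u) (b *\<^sub>R v) (c *\<^sub>R w) = a * b * c * det3 u v w"
  by (simp add: det3_expand algebra_simps)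

lemma glick_of_lift_scale:
  assumes "\<And>i. c i \<noteq> 0" "\<And>i. q' i = c i *\<^sub>R q i"
  shows "glick_of_lift q' v = glick_of_lift q v"
proof -
  have "(det3 (q' (j - 1)) v (q' (j + 1)) / det3 (q' (j - 1)) (q' j) (q' (j + 1))) *\<^sub>R q' j =
        (det3 (q (j - 1)) v (q (j + 1)) / det3 (q (j - 1)) (q j) (q (j + 1))) *\<^sub>R q j" for j
    using assms(1)[of j] assms(1)[of "j - 1"] assms(1)[of "j + 1"]
      det3_scale[of "c (j - 1)" "q (j - 1)" 1 v "c (j + 1)" "q (j + 1)"]
    by (simp add: assms(2) det3_scale)
  then show ?thesis
    by (simp add: glick_of_lift_def)
qed

lemma glick_eq_glick_of_lift:
  assumes "homogeneous_lift q P"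
  shows "glick P = glick_of_lift q"
proof -
  obtain c where "\<And>i. c i \<noteq> 0" "\<And>i. some_lift P i = c i *\<^sub>R q i"
    using homogeneous_lift_scale[OF assms homogeneous_lift_some_lift] by blast
  then show ?thesis
    unfolding glick_def by (intro ext glick_of_lift_scale)
qed

lemma linear_glick: "linear (glick P)"
proof -
  have "det3 a (u + v) b = det3 a u b + det3 a v b" "det3 a (r *\<^sub>R u) b = r * det3 a u b"
    for a u v b r by (simp_all add: det3_expand algebra_simps)
  then show ?thesis
    unfolding glick_def
    by (intro linearI)
      (simp_all add: glick_of_lift_def add_divide_distrib scaleR_add_left scaleR_add_right
        sum.distrib scaleR_diff_right scaleR_sum_right)
qed

end

theory Submission
  imports Defs
begin

text \<open>A projective transformation conjugates \<open>G\<^sub>P\<close>, so its trace, the trace of its square and its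
  determinant may be computed for the vertices \<open>e\<^sub>1, e\<^sub>2, e\<^sub>3, (1, b, c), (d, e, 1)\<close>; this gives
  the cubic \<open>t\<^sup>3 - t\<^sup>2 + \<kappa>t + \<kappa>\<close>. Its discriminant is \<open>- 4\<kappa>(\<kappa>\<^sup>2 + 11\<kappa> - 1)\<close>, whose sign
  decides which roots are real. The roots have sum \<open>1\<close>, so a pair of opposite roots would make \<open>1\<close> a
  root and hence \<open>\<kappa> = 0\<close>; a real root \<open>a\<close> with companions \<open>z\<close>, \<open>cnj z\<close> satisfies
  \<open>a (a\<^sup>2 - cmod z\<^sup>2) = a (a - \<kappa>)\<close>.

  The edges of a convex pentagon are exposed by supporting lines, so after a global choice of sign
  all brackets \<open>[i, i + 1, j]\<close> are positive. Rescaling the frame then brings the pentagon to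
  \<open>e\<^sub>1, e\<^sub>2, e\<^sub>3, (1, -1, 1 + w), (1 + s, -1, 1)\<close> with \<open>s, w > 0\<close>, where
  \<open>- \<kappa> = (1 + s) (1 + w) (s + w + s w) / (s w)\<close>. This is minimal exactly for
  \<open>s = w = 1 / \<phi>\<close>. The regular pentagon attains the minimum, so it has the same normal form as
  every other minimiser.\<close>

section \<open>Lifts and the invariance of \<open>kappa\<close>\<close>

lemma UNIV_5: "(UNIV :: 5 set) = {0, 1, 2, 3, 4}"
proof -
  have "card {0, 1, 2, 3, 4 :: 5} = CARD(5)"
    by simp
  then show ?thesis
    by (metis card_subset_eq finite_class.finite_UNIV top_greatest)
qed

lemma forall_5: "(\<forall>i :: 5. Q i) \<longleftrightarrow> Q 0 \<and> Q 1 \<and> Q 2 \<and> Q 3 \<and> Q 4"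
  using UNIV_5 by (metis UNIV_I insertE singletonD)

lemma exhaust_5: "(i :: 5) = 0 \<or> i = 1 \<or> i = 2 \<or> i = 3 \<or> i = 4"
  using UNIV_5 by blast

lemma numeral_mod_5: "(5 :: 5) = 0" "(6 :: 5) = 1" "(7 :: 5) = 2" "(8 :: 5) = 3" "- (1 :: 5) = 4"
  by simp_all

lemma sum_5: "(\<Sum>j\<in>UNIV. f (j :: 5)) = f 0 + f 1 + f 2 + f 3 + (f 4 :: 'a :: comm_monoid_add)"
  unfolding UNIV_5 by (simp add: add.assoc)

lemma prod_5: "(\<Prod>j\<in>UNIV. f (j :: 5)) = f 0 * f 1 * f 2 * f 3 * (f 4 :: 'a :: comm_monoid_mult)"
  unfolding UNIV_5 by (simp add: mult.assoc)

lemma det3_matrix_mult: "det3 (M *v u) (M *v v) (M *v w) = det M * det3 u v w"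
proof -
  have "(vector [M *v u, M *v v, M *v w] :: real^3^3) = vector [u, v, w] ** transpose M"
    by (simp add: vec_eq_iff forall_3 matrix_vector_mult_def matrix_matrix_mult_def transpose_def
        sum_3 mult.commute)
  then show ?thesis
    by (simp add: det3_def det_mul)
qed

text \<open>The rows of the matrix are the three lifts, so a kernel vector \<open>l\<close> is
  exactly a line through the three points. This turns collinearity into a vanishing bracket.\<close>

lemma det3_eq_0_iff: "det3 u v w = 0 \<longleftrightarrow> (\<exists>l. l \<noteq> 0 \<and> l \<bullet> u = 0 \<and> l \<bullet> v = 0 \<and> l \<bullet> w = 0)"
proof -
  have "(vector [u, v, w] :: real^3^3) *v l = 0 \<longleftrightarrow> l \<bullet> u = 0 \<and> l \<bullet> v = 0 \<and> l \<bullet> w = 0" for l :: "real^3"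
    by (simp add: vec_eq_iff forall_3 matrix_vector_mul_component inner_commute)
  then show ?thesis
    unfolding det3_def
    using invertible_det_nz[of "vector [u, v, w] :: real^3^3"]
      invertible_left_inverse[of "vector [u, v, w] :: real^3^3"]
      matrix_left_invertible_ker[of "vector [u, v, w] :: real^3^3"]
    by blast
qed

lemma proj_pt_in_proj_line:
  assumes "u \<noteq> 0"
  shows "proj_pt u \<in> proj_line l \<longleftrightarrow> l \<bullet> u = 0"
proof
  assume "proj_pt u \<in> proj_line l"
  then obtain v where v: "v \<noteq> 0" "l \<bullet> v = 0" "proj_pt u = proj_pt v"
    unfolding proj_line_def by blast
  with assms obtain c where "c \<noteq> 0" "v = c *\<^sub>R u"
    using proj_pt_eq_iff by blast
  with v show "l \<bullet> u = 0"
    by simp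
qed (use assms in \<open>auto simp: proj_line_def\<close>)

lemma glick_domain_iff:
  assumes "homogeneous_lift q P"
  shows "glick_domain P \<longleftrightarrow> (\<forall>i. det3 (q (i - 1)) (q i) (q (i + 1)) \<noteq> 0)"
proof -
  have "P i \<in> proj_line l \<longleftrightarrow> l \<bullet> q i = 0" for i l
    using assms proj_pt_in_proj_line[of "q i" l] by (auto simp: homogeneous_lift_def)
  then show ?thesis
    unfolding glick_domain_def proj_collinear_def det3_eq_0_iff by simp
qed

lemma homogeneous_lift_rescale:
  assumes "homogeneous_lift q P" "\<And>i. c i \<noteq> 0"
  shows "homogeneous_lift (\<lambda>i. c i *\<^sub>R q i) P"
  unfolding homogeneous_lift_def
proof (intro allI conjI)
  fix i
  have q: "q i \<noteq> 0" "proj_pt (q i) = P i"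
    using assms(1) by (auto simp: homogeneous_lift_def)
  then show "c i *\<^sub>R q i \<noteq> 0"
    using assms(2)[of i] by simp
  then have "proj_pt (q i) = proj_pt (c i *\<^sub>R q i)"
    using proj_pt_eq_iff[of "q i" "c i *\<^sub>R q i"] q assms(2)[of i] by blast
  with q show "proj_pt (c i *\<^sub>R q i) = P i"
    by simp
qed

lemma homogeneous_lift_projective:
  assumes "homogeneous_lift q P" "invertible M" "\<And>v. v \<noteq> 0 \<Longrightarrow> f (proj_pt v) = proj_pt (M *v v)"
  shows "homogeneous_lift (\<lambda>i. M *v q i) (f \<circ> P)"
proof -
  have "M *v v \<noteq> 0" if "v \<noteq> 0" for v
    using assms(2) that by (metis invertible_def matrix_vector_mul_assoc matrix_vector_mul_lid
        matrix_vector_mult_0_right)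
  then show ?thesis
    using assms(1,3) unfolding homogeneous_lift_def by (metis comp_apply)
qed

lemma homogeneous_lift_relabel:
  "homogeneous_lift q P \<Longrightarrow> homogeneous_lift (\<lambda>i. q (i + s)) (relabel s P)"
  by (simp add: homogeneous_lift_def relabel_def)

text \<open>Only \<open>[315]\<close> and \<open>[425]\<close> need an odd reordering, so the signs
  cancel. In cyclic form, relabelling merely permutes the factors.\<close>

lemma kappa_num_eq_prod: "kappa_num q = (\<Prod>i\<in>UNIV. det3 (q i) (q (i + 2)) (q (i + 3)))"
proof -
  have "det3 (q 3) (q 1) (q 0) = - det3 (q 3) (q 0) (q 1)"
    "det3 (q 4) (q 2) (q 0) = - det3 (q 2) (q 4) (q 0)"
    "det3 (q 2) (q 3) (q 0) = det3 (q 0) (q 2) (q 3)"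
    "det3 (q 1) (q 2) (q 4) = det3 (q 4) (q 1) (q 2)"
    by (simp_all add: det3_expand algebra_simps)
  then show ?thesis
    by (simp add: kappa_num_def bracket_def prod_5 numeral_mod_5)
qed

text \<open>Here \<open>[415]\<close> is the only odd reordering, hence the minus sign. The factors
  are precisely the brackets that define the domain of Glick's operator.\<close>

lemma kappa_den_eq_prod: "kappa_den q = - (\<Prod>i\<in>UNIV. det3 (q (i - 1)) (q i) (q (i + 1)))"
proof -
  have "det3 (q 4) (q 1) (q 0) = - det3 (q 4) (q 0) (q 1)"
    "det3 (q 1) (q 2) (q 0) = det3 (q 0) (q 1) (q 2)"
    by (simp_all add: det3_expand algebra_simps)
  then show ?thesis
    by (simp add: kappa_den_def bracket_def prod_5 numeral_mod_5)
qed

lemma kappa_den_nonzero: "homogeneous_lift q P \<Longrightarrow> glick_domain P \<Longrightarrow> kappa_den q \<noteq> 0"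
  by (simp add: kappa_den_eq_prod glick_domain_iff)

text \<open>Each label occurs in exactly three of the five brackets, whence the cube. The same count
  holds for the denominator, so the factor cancels in \<open>kappa\<close>.\<close>

lemma kappa_num_rescale: "kappa_num (\<lambda>i. c i *\<^sub>R q i) = (\<Prod>i\<in>UNIV. c i) ^ 3 * kappa_num q"
  by (simp add: kappa_num_def bracket_def prod_5 numeral_mod_5 det3_scale power3_eq_cube)

lemma kappa_den_rescale: "kappa_den (\<lambda>i. c i *\<^sub>R q i) = (\<Prod>i\<in>UNIV. c i) ^ 3 * kappa_den q"
  by (simp add: kappa_den_def bracket_def prod_5 numeral_mod_5 det3_scale power3_eq_cube)

lemma kappa_eq:
  assumes "homogeneous_lift q P"
  shows "kappa P = kappa_num q / kappa_den q"
proof -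
  obtain c where c: "\<And>i. c i \<noteq> 0" "\<And>i. some_lift P i = c i *\<^sub>R q i"
    using homogeneous_lift_scale[OF assms homogeneous_lift_some_lift] by blast
  then have "some_lift P = (\<lambda>i. c i *\<^sub>R q i)"
    by auto
  then show ?thesis
    using c(1) by (simp add: kappa_def kappa_num_rescale kappa_den_rescale)
qed

lemma glick_domain_projective:
  assumes "glick_domain P" "projective_transformation f"
  shows "glick_domain (f \<circ> P)"
proof -
  obtain q where q: "homogeneous_lift q P"
    using ex_homogeneous_lift by blast
  obtain M where M: "invertible M" "\<And>v. v \<noteq> 0 \<Longrightarrow> f (proj_pt v) = proj_pt (M *v v)"
    using assms(2) by (auto simp: projective_transformation_def)
  show ?thesis
    using assms(1) M(1) glick_domain_iff[OF q] glick_domain_iff[OF homogeneous_lift_projective[OF q M]]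
    by (simp add: det3_matrix_mult invertible_det_nz)
qed

lemma kappa_projective:
  assumes "projective_transformation f"
  shows "kappa (f \<circ> P) = kappa P"
proof -
  obtain q where q: "homogeneous_lift q P"
    using ex_homogeneous_lift by blast
  obtain M where M: "invertible M" "\<And>v. v \<noteq> 0 \<Longrightarrow> f (proj_pt v) = proj_pt (M *v v)"
    using assms by (auto simp: projective_transformation_def)
  show ?thesis
    using M(1) kappa_eq[OF q] kappa_eq[OF homogeneous_lift_projective[OF q M]]
    by (simp add: kappa_num_def kappa_den_def bracket_def det3_matrix_mult invertible_det_nz)
qed

lemma glick_domain_relabel:
  assumes "glick_domain P"
  shows "glick_domain (relabel s P)"
  using assms unfolding glick_domain_def relabel_def
  by (metis add.assoc add.commute diff_add_eq)

lemma kappa_relabel: "kappa (relabel s P) = kappa P"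
proof -
  obtain q where q: "homogeneous_lift q P"
    using ex_homogeneous_lift by blast
  have shift: "(\<Prod>i\<in>UNIV. h (i + s)) = (\<Prod>i\<in>UNIV. h i)" for h :: "5 \<Rightarrow> real"
    by (intro prod.reindex_bij_witness[of _ "\<lambda>i. i - s" "\<lambda>i. i + s"]) auto
  have "kappa_num (\<lambda>i. q (i + s)) = kappa_num q"
    using shift[of "\<lambda>i. det3 (q i) (q (i + 2)) (q (i + 3))"]
    by (simp add: kappa_num_eq_prod add_ac)
  moreover have "kappa_den (\<lambda>i. q (i + s)) = kappa_den q"
    using shift[of "\<lambda>i. det3 (q (i - 1)) (q i) (q (i + 1))"]
    by (simp add: kappa_den_eq_prod algebra_simps)
  ultimately show ?thesis
    using kappa_eq[OF q] kappa_eq[OF homogeneous_lift_relabel[OF q]] by simp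
qed

section \<open>The characteristic polynomial\<close>

lemma trace_3: "trace (A :: real^3^3) = A$1$1 + A$2$2 + A$3$3"
  by (simp add: trace_def sum_3)

text \<open>By Newton's identity the middle coefficient is the second elementary symmetric function
  of the eigenvalues. Three quantities that are stable under conjugation thus determine the
  polynomial.\<close>

lemma charpoly_3:
  fixes A :: "real^3^3"
  shows "charpoly A = [:- det A, ((trace A)\<^sup>2 - trace (A ** A)) / 2, - trace A, 1:]"
  by (simp add: charpoly_def det_3 mat_def trace_3 matrix_matrix_mult_def sum_3 power2_eq_square
      algebra_simps)

text \<open>The matrix of \<open>G_op\<close> in terms of a lift, so that it can be evaluated at
  explicit vectors.\<close>

definition glick_matrix :: "(5 \<Rightarrow> real^3) \<Rightarrow> real^3^3" where
  "glick_matrix q = matrix (\<lambda>v. glick_of_lift q v - 3 *\<^sub>R v)"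

lemma matrix_G_op: "homogeneous_lift q P \<Longrightarrow> matrix (G_op P) = glick_matrix q"
  unfolding glick_matrix_def G_op_def by (simp add: glick_eq_glick_of_lift[symmetric])

text \<open>\<open>10/3 = 3 + 1/3\<close>, and \<open>1/3\<close> is a third of the trace of
  \<open>G_op P\<close> on the domain, so \<open>L_hat\<close> is the trace-free part there.\<close>

lemma matrix_L_hat: "matrix (L_hat P) = matrix (G_op P) - mat (1/3)"
proof -
  have "L_hat P v = G_op P v - (1/3) *\<^sub>R v" for v
    by (simp add: L_hat_def G_op_def vec_eq_iff)
  then show ?thesis
    by (simp add: vec_eq_iff matrix_def mat_def axis_def)
qed

lemma linear_L_hat: "linear (L_hat P)"
  unfolding L_hat_def by (intro linear_compose_sub linear_glick linear_scaleR)

lemma linear_glick_of_lift: "linear (glick_of_lift q)"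
proof -
  have "det3 a (u + v) b = det3 a u b + det3 a v b" "det3 a (r *\<^sub>R u) b = r * det3 a u b"
    for a u v b r by (simp_all add: det3_expand algebra_simps)
  then show ?thesis
    by (intro linearI)
      (simp_all add: glick_of_lift_def add_divide_distrib scaleR_add_left scaleR_add_right
        sum.distrib scaleR_diff_right scaleR_sum_right)
qed

lemma glick_matrix_works: "glick_matrix q *v v = glick_of_lift q v - 3 *\<^sub>R v"
proof -
  have "linear (\<lambda>v. glick_of_lift q v - 3 *\<^sub>R v)"
    by (intro linear_compose_sub linear_glick_of_lift linear_scaleR)
  then show ?thesis
    unfolding glick_matrix_def by (simp add: matrix_works)
qed

text \<open>Both brackets of each quotient acquire the factor \<open>det M\<close>, which cancels;
  only the vectors \<open>q j\<close> are moved by \<open>M\<close>.\<close>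

lemma glick_of_lift_projective:
  assumes "invertible M"
  shows "glick_of_lift (\<lambda>i. M *v q i) (M *v v) = M *v glick_of_lift q v"
proof -
  have "det M \<noteq> 0"
    using assms invertible_det_nz by blast
  then show ?thesis
    by (simp add: glick_of_lift_def det3_matrix_mult matrix_vector_mult_diff_distrib
        matrix_vector_mult_scaleR linear_sum[OF matrix_vector_mul_linear])
qed

lemma glick_matrix_projective:
  assumes "invertible M"
  shows "glick_matrix (\<lambda>i. M *v q i) ** M = M ** glick_matrix q"
  unfolding matrix_eq
  using assms by (simp add: glick_matrix_works glick_of_lift_projective matrix_vector_mult_diff_distrib
      matrix_vector_mult_scaleR flip: matrix_vector_mul_assoc)

lemma similar_invariants:
  fixes A B M :: "real^'n^'n"
  assumes "invertible M" "A ** M = M ** B"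
  shows "det A = det B" "trace A = trace B" "trace (A ** A) = trace (B ** B)"
proof -
  obtain N where N: "M ** N = mat 1" "N ** M = mat 1"
    using assms(1) by (auto simp: invertible_def)
  have A: "A = M ** B ** N"
    using assms(2) N(1) by (metis matrix_mul_assoc matrix_mul_rid)
  have "det M * det N = 1"
    using N(1) by (metis det_I det_mul)
  then show "det A = det B"
    by (simp add: A det_mul)
  have *: "trace (M ** C ** N) = trace C" for C :: "real^'n^'n"
    by (metis N(2) matrix_mul_assoc matrix_mul_lid trace_mul_sym)
  then show "trace A = trace B"
    by (simp add: A)
  have "A ** A = M ** (B ** B) ** N"
    by (metis A N(2) matrix_mul_assoc matrix_mul_rid)
  then show "trace (A ** A) = trace (B ** B)"
    by (simp add: *)
qed

text \<open>The first three vertices are taken as the projective frame, and the lifts of the other two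
  are scaled so that \<open>[123] = [234] = [512] = 1\<close>.\<close>

definition std_pentagon :: "real \<Rightarrow> real \<Rightarrow> real \<Rightarrow> real \<Rightarrow> 5 \<Rightarrow> real^3" where
  "std_pentagon b c d e i =
     (if i = 1 then vector [1, 0, 0] else if i = 2 then vector [0, 1, 0]
      else if i = 3 then vector [0, 0, 1] else if i = 4 then vector [1, b, c] else vector [d, e, 1])"

lemma std_pentagon_simps [simp]:
  "std_pentagon b c d e 0 = vector [d, e, 1]" "std_pentagon b c d e 1 = vector [1, 0, 0]"
  "std_pentagon b c d e 2 = vector [0, 1, 0]" "std_pentagon b c d e 3 = vector [0, 0, 1]"
  "std_pentagon b c d e 4 = vector [1, b, c]"
  by (simp_all add: std_pentagon_def)

lemma kappa_std_pentagon:
  "kappa_num (std_pentagon b c d e) = b * c * d * e * (c * d - 1)"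
  "kappa_den (std_pentagon b c d e) = - ((e - b * d) * (b - c * e))"
  by (simp_all add: kappa_num_def kappa_den_def bracket_def numeral_mod_5 det3_expand algebra_simps)

text \<open>\<open>m\<close> is \<open>[345]\<close> and \<open>n\<close> is \<open>[451]\<close>.
  The other three consecutive brackets are 1, so no further denominators occur in Glick's
  operator.\<close>

lemma glick_matrix_std_pentagon:
  assumes "e - b * d \<noteq> 0" "b - c * e \<noteq> 0"
  defines "m \<equiv> e - b * d" and "n \<equiv> b - c * e"
  shows "glick_matrix (std_pentagon b c d e) = vector
    [vector [1 - e / m, d / m + c * d / n, d - b * d / n],
     vector [- b * e / m, 1 + b * d / m + c * e / n, - b * e / n],
     vector [c - c * e / m, c * d / m + c / n, 1 - b / n]]"
  using assms(1,2)
  by (simp add: glick_matrix_def matrix_def glick_of_lift_def sum_5 numeral_mod_5 vec_eq_iff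
      forall_3 det3_expand axis_def flip: m_def n_def)

text \<open>Given trace 1, the value \<open>1 - 2 * k\<close> says that the second elementary
  symmetric function is \<open>k\<close>.\<close>

lemma invariants_std_pentagon:
  assumes "e - b * d \<noteq> 0" "b - c * e \<noteq> 0"
  defines "k \<equiv> b * c * d * e * (c * d - 1) / - ((e - b * d) * (b - c * e))"
  defines "G \<equiv> glick_matrix (std_pentagon b c d e)"
  shows "trace G = 1" "trace (G ** G) = 1 - 2 * k" "det G = - k"
proof -
  define m n where "m = e - b * d" and "n = b - c * e"
  have mn: "m \<noteq> 0" "n \<noteq> 0"
    using assms by (auto simp: m_def n_def)
  note G = glick_matrix_std_pentagon[OF assms(1,2), folded G_def, folded m_def n_def]
  have K: "k = - b * c * d * e * (c * d - 1) / (m * n)"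
    by (simp add: k_def m_def n_def)
  show "trace G = 1"
    \<comment> \<open>\<open>m\<close> and \<open>n\<close> stay opaque while denominators are
      cleared; unfolding them afterwards leaves a polynomial identity in \<open>b\<close>,
      \<open>c\<close>, \<open>d\<close>, \<open>e\<close>.\<close>
    using mn by (simp add: G trace_3 field_simps) (unfold m_def n_def, algebra)
  show "trace (G ** G) = 1 - 2 * k"
    using mn by (simp add: G trace_3 matrix_matrix_mult_def sum_3 K)
      (simp add: field_simps, unfold m_def n_def, algebra)
  show "det G = - k"
    using mn by (simp add: G det_3 K) (simp add: field_simps, unfold m_def n_def, algebra)
qed

section \<open>Projective frames and the reduction to the normal form\<close>

definition frame :: "real^3 \<Rightarrow> real^3 \<Rightarrow> real^3 \<Rightarrow> real^3^3" where
  "frame u v w = transpose (vector [u, v, w])"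

text \<open>The transpose makes \<open>u\<close>, \<open>v\<close>, \<open>w\<close> the columns, so
  the frame carries the standard basis, that is, vertices 1, 2, 3 of the normal form, to
  them.\<close>

lemma frame_mult: "frame u v w *v vector [x, y, z] = x *\<^sub>R u + y *\<^sub>R v + z *\<^sub>R w"
  by (simp add: frame_def transpose_def matrix_vector_mult_def vec_eq_iff sum_3 mult.commute)

lemma invertible_frame: "invertible (frame u v w) \<longleftrightarrow> det3 u v w \<noteq> 0"
  by (simp add: frame_def det3_def invertible_det_nz)

lemma det3_coordinates:
  assumes "det3 u v w \<noteq> 0"
  obtains x y z where "p = x *\<^sub>R u + y *\<^sub>R v + z *\<^sub>R w"
proof -
  obtain N where "frame u v w ** N = mat 1"
    using assms invertible_frame[of u v w] unfolding invertible_def by blast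
  then have "frame u v w *v (N *v p) = p"
    by (simp add: matrix_vector_mul_assoc)
  moreover have "N *v p = vector [(N *v p) $ 1, (N *v p) $ 2, (N *v p) $ 3]"
    by (simp add: vec_eq_iff forall_3)
  ultimately show thesis
    using that frame_mult by metis
qed

text \<open>Five free scalars, one for each lift, so that the general normal form and the finer one
  for convex pentagons are both instances.\<close>

lemma homogeneous_lift_std_pentagon:
  assumes q: "homogeneous_lift q P"
    and nz: "l1 \<noteq> 0" "l2 \<noteq> 0" "l3 \<noteq> 0" "m4 \<noteq> 0" "m0 \<noteq> 0"
    and q4: "m4 *\<^sub>R q 4 = l1 *\<^sub>R q 1 + (b * l2) *\<^sub>R q 2 + (c * l3) *\<^sub>R q 3"
    and q0: "m0 *\<^sub>R q 0 = (d * l1) *\<^sub>R q 1 + (e * l2) *\<^sub>R q 2 + l3 *\<^sub>R q 3"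
  shows "homogeneous_lift
    (\<lambda>i. frame (l1 *\<^sub>R q 1) (l2 *\<^sub>R q 2) (l3 *\<^sub>R q 3) *v std_pentagon b c d e i) P"
proof -
  define g :: "5 \<Rightarrow> real" where
    "g i = (if i = 1 then l1 else if i = 2 then l2 else if i = 3 then l3 else if i = 4 then m4 else m0)" for i
  have "frame (l1 *\<^sub>R q 1) (l2 *\<^sub>R q 2) (l3 *\<^sub>R q 3) *v std_pentagon b c d e i = g i *\<^sub>R q i" for i
    using exhaust_5[of i] q4 q0 by (auto simp: g_def frame_mult)
  moreover have "g i \<noteq> 0" for i
    using nz by (simp add: g_def)
  ultimately show ?thesis
    using homogeneous_lift_rescale[OF q, of g] by simp
qed

text \<open>\<open>[123]\<close> being nonzero gives a basis, \<open>[234]\<close> and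
  \<open>[512]\<close> allow division by the leading coefficients \<open>a\<close> and
  \<open>f\<close>, and \<open>[345]\<close> and \<open>[451]\<close> become the two nonzero
  denominators.\<close>

lemma glick_domain_std_pentagon:
  assumes "glick_domain P"
  obtains M b c d e where "invertible M" "homogeneous_lift (\<lambda>i. M *v std_pentagon b c d e i) P"
    "e - b * d \<noteq> 0" "b - c * e \<noteq> 0"
proof -
  obtain q where q: "homogeneous_lift q P"
    using ex_homogeneous_lift by blast
  have nz: "det3 (q (i - 1)) (q i) (q (i + 1)) \<noteq> 0" for i
    using assms glick_domain_iff[OF q] by blast
  have D: "det3 (q 1) (q 2) (q 3) \<noteq> 0"
    using nz[of 2] by simp
  obtain a b c where q4: "q 4 = a *\<^sub>R q 1 + b *\<^sub>R q 2 + c *\<^sub>R q 3"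
    using det3_coordinates[OF D] by blast
  obtain d e f where q0: "q 0 = d *\<^sub>R q 1 + e *\<^sub>R q 2 + f *\<^sub>R q 3"
    using det3_coordinates[OF D] by blast
  have "det3 (q 2) (q 3) (q 4) = a * det3 (q 1) (q 2) (q 3)"
    unfolding q4 by (simp add: det3_expand algebra_simps)
  then have a: "a \<noteq> 0"
    using nz[of 3] by auto
  have "det3 (q 0) (q 1) (q 2) = f * det3 (q 1) (q 2) (q 3)"
    unfolding q0 by (simp add: det3_expand algebra_simps)
  then have f: "f \<noteq> 0"
    using nz[of 1] by auto
  define M where "M = frame (1 *\<^sub>R q 1) (1 *\<^sub>R q 2) (1 *\<^sub>R q 3)"
  have M: "invertible M"
    using D by (simp add: M_def invertible_frame)
  have lift: "homogeneous_lift (\<lambda>i. M *v std_pentagon (b / a) (c / a) (d / f) (e / f) i) P"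
    unfolding M_def
    by (rule homogeneous_lift_std_pentagon[OF q, where ?m4.0 = "1 / a" and ?m0.0 = "1 / f"])
      (use a f in \<open>simp_all add: q4 q0 scaleR_add_right divide_inverse_commute\<close>)
  then have "det3 (std_pentagon (b / a) (c / a) (d / f) (e / f) (i - 1))
      (std_pentagon (b / a) (c / a) (d / f) (e / f) i)
      (std_pentagon (b / a) (c / a) (d / f) (e / f) (i + 1)) \<noteq> 0" for i
    using assms by (simp add: glick_domain_iff det3_matrix_mult)
  from this[of 4] this[of 0] show thesis
    using that[OF M lift] by (simp add: numeral_mod_5 det3_expand algebra_simps)
qed

section \<open>The roots of the cubic\<close>

definition glick_cubic :: "real \<Rightarrow> real poly" where
  "glick_cubic k = [:k, k, -1, 1:]"

text \<open>Vieta read backwards: the symmetric functions reassemble the product of the linear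
  factors, which shows the roots with multiplicity.\<close>

lemma proots_glick_cubic:
  assumes "x + y + z = 1" "x * y + y * z + z * x = of_real k" "x * y * z = - of_real k"
  shows "proots (map_poly complex_of_real (glick_cubic k)) = {#x, y, z#}"
proof -
  have "map_poly complex_of_real (glick_cubic k) = [:of_real k, of_real k, -1, 1:]"
    by (simp add: glick_cubic_def map_poly_pCons)
  also have "\<dots> = [:- (x * y * z), x * y + y * z + z * x, - (x + y + z), 1:]"
    unfolding assms by simp
  also have "\<dots> = [:- x, 1:] * [:- y, 1:] * [:- z, 1:]"
    by (simp add: algebra_simps)
  finally show ?thesis
    by (simp add: proots_mult del: mult_pCons_left mult_pCons_right)
qed

lemma proots_glick_cubic_of_real:
  assumes "a + b + c = 1" "a * b + b * c + c * a = k" "a * b * c = - k"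
  shows "proots (map_poly complex_of_real (glick_cubic k)) = {#of_real a, of_real b, of_real c#}"
  by (rule proots_glick_cubic) (use assms in \<open>simp_all flip: of_real_add of_real_mult of_real_minus\<close>)

lemma kappa_plus_minus:
  "k\<^sup>2 + 11 * k - 1 = (k - kappa_minus) * (k - kappa_plus)" "kappa_minus < 0" "0 < kappa_plus"
proof -
  have "sqrt 5 * sqrt 5 = 5"
    by simp
  then show "k\<^sup>2 + 11 * k - 1 = (k - kappa_minus) * (k - kappa_plus)"
    by (simp add: kappa_minus_def kappa_plus_def field_simps power2_eq_square)
  \<comment> \<open>\<open>121 / 25 < 5\<close>; this is \<open>11 < 5 * sqrt 5\<close>, the sign of
    \<open>kappa_plus\<close>.\<close>
  have "11 / 5 < sqrt 5"
    by (rule real_less_rsqrt) (simp add: power2_eq_square)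
  then show "kappa_minus < 0" "0 < kappa_plus"
    by (simp_all add: kappa_minus_def kappa_plus_def)
qed

text \<open>At \<open>- 1\<close> the cubic is \<open>- 2\<close> whatever \<open>k\<close> is. At
  \<open>b\<close> it equals \<open>b\<^sup>2 * (b - 1) + k * (b + 1)\<close>, and
  \<open>b - 1 = 1 + \<bar>k\<bar>\<close> makes the first term dominate.\<close>

lemma glick_cubic_real_root: obtains a where "poly (glick_cubic k) a = 0"
proof -
  define b where "b = 2 + \<bar>k\<bar>"
  have "\<bar>k\<bar> * (b + 1) \<le> \<bar>k\<bar> * b\<^sup>2"
    by (intro mult_left_mono) (auto simp: b_def power2_eq_square algebra_simps)
  moreover have "- (\<bar>k\<bar> * (b + 1)) \<le> k * (b + 1)"
    unfolding mult_minus_left[symmetric] by (intro mult_right_mono) (auto simp: b_def)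
  moreover have "b\<^sup>2 * (b - 1) = b\<^sup>2 + \<bar>k\<bar> * b\<^sup>2"
    by (simp add: b_def algebra_simps)
  moreover have "b\<^sup>2 > 0"
    by (simp add: b_def)
  ultimately have "b\<^sup>2 * (b - 1) + k * (b + 1) > 0"
    by linarith
  then have "0 < poly (glick_cubic k) b"
    by (simp add: glick_cubic_def algebra_simps power2_eq_square)
  moreover have "poly (glick_cubic k) (- 1) < 0"
    by (simp add: glick_cubic_def)
  moreover have "- 1 < b"
    by (simp add: b_def)
  ultimately show thesis
    using poly_IVT_pos that by blast
qed

text \<open>Splitting off the real root \<open>a\<close> leaves \<open>t\<^sup>2 + (a - 1) t + r\<close>. The discriminant of the
  cubic is that of the quadratic factor times the square of its value at \<open>a\<close>.\<close>

lemma glick_cubic_split: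
  obtains a r where "a * r = - k" "r = k + a\<^sup>2 - a"
    "((a - 1)\<^sup>2 - 4 * r) * (a\<^sup>2 + (a - 1) * a + r)\<^sup>2 = - 4 * k * ((k - kappa_minus) * (k - kappa_plus))"
proof -
  obtain a where "poly (glick_cubic k) a = 0"
    using glick_cubic_real_root by blast
  then have a: "k + a * (k + a * (a - 1)) = 0"
    by (simp add: glick_cubic_def)
  \<comment> \<open>The product of the other two roots, read off from the linear coefficient
    \<open>k = a * (1 - a) + r\<close>.\<close>
  define r where "r = k + a\<^sup>2 - a"
  have "a * r = - k"
    using a unfolding r_def by algebra
  moreover have "((a - 1)\<^sup>2 - 4 * r) * (a\<^sup>2 + (a - 1) * a + r)\<^sup>2 = - 4 * k * (k\<^sup>2 + 11 * k - 1)"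
    using a unfolding r_def by algebra
  ultimately show thesis
    using that[of a r] by (simp add: r_def kappa_plus_minus(1))
qed

lemma glick_cubic_real_spectrum:
  assumes "k < kappa_minus \<or> 0 < k \<and> k < kappa_plus"
  obtains a b c :: real where "distinct [\<bar>a\<bar>, \<bar>b\<bar>, \<bar>c\<bar>]"
    "proots (map_poly complex_of_real (glick_cubic k)) = {#of_real a, of_real b, of_real c#}"
proof -
  obtain a r where ar: "a * r = - k" "r = k + a\<^sup>2 - a"
    and disc: "((a - 1)\<^sup>2 - 4 * r) * (a\<^sup>2 + (a - 1) * a + r)\<^sup>2
      = - 4 * k * ((k - kappa_minus) * (k - kappa_plus))"
    by (rule glick_cubic_split)
  define D where "D = (a - 1)\<^sup>2 - 4 * r"
  have "- 4 * k * ((k - kappa_minus) * (k - kappa_plus)) > 0"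
    using assms kappa_plus_minus(2,3)
    by (auto intro!: mult_neg_pos mult_pos_neg mult_neg_neg simp: mult_less_0_iff zero_less_mult_iff)
  with disc have pos: "D * (a\<^sup>2 + (a - 1) * a + r)\<^sup>2 > 0"
    by (simp add: D_def)
  then have D: "D > 0" and ne: "a\<^sup>2 + (a - 1) * a + r \<noteq> 0"
    by (auto simp: zero_less_mult_iff)
  define b where "b = (1 - a + sqrt D) / 2"
  define c where "c = (1 - a - sqrt D) / 2"
  have sq: "(sqrt D)\<^sup>2 = (a - 1)\<^sup>2 - 4 * r"
    using D by (simp add: D_def)
  have sum: "a + b + c = 1"
    by (simp add: b_def c_def field_simps)
  have bc: "b * c = r"
    using sq unfolding b_def c_def by (simp add: field_simps power2_eq_square)
  have e2: "a * b + b * c + c * a = k"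
    using sum bc ar by algebra
  have e3: "a * b * c = - k"
    using ar bc by (simp add: mult.assoc)
  have k: "k \<noteq> 0"
    using assms kappa_plus_minus by auto
  \<comment> \<open>\<open>D > 0\<close> separates \<open>b\<close> from \<open>c\<close>, and
    \<open>ne\<close> says \<open>(a - b) * (a - c) \<noteq> 0\<close>. Opposite roots
    \<open>x\<close>, \<open>- x\<close> would leave 1 as the third, and then
    \<open>k = - x\<^sup>2\<close> and \<open>k = x\<^sup>2\<close>.\<close>
  have "b \<noteq> c"
    using D by (simp add: b_def c_def)
  moreover have "a \<noteq> b" "a \<noteq> c"
    using ne sum bc by algebra+
  moreover have "a + b \<noteq> 0" "b + c \<noteq> 0" "c + a \<noteq> 0"
    using sum e2 e3 k by algebra+
  ultimately have "distinct [\<bar>a\<bar>, \<bar>b\<bar>, \<bar>c\<bar>]"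
    by (auto simp: abs_eq_iff)
  moreover have "proots (map_poly complex_of_real (glick_cubic k)) = {#of_real a, of_real b, of_real c#}"
    using sum e2 e3 by (rule proots_glick_cubic_of_real)
  ultimately show thesis
    using that by blast
qed

lemma glick_cubic_nonreal_spectrum:
  assumes "kappa_minus < k \<and> k < 0 \<or> kappa_plus < k"
  obtains a :: real and z :: complex where "Im z \<noteq> 0"
    "proots (map_poly complex_of_real (glick_cubic k)) = {#of_real a, z, cnj z#}"
    "k < 0 \<Longrightarrow> cmod z < \<bar>a\<bar>" "k > 0 \<Longrightarrow> \<bar>a\<bar> < cmod z"
proof -
  obtain a r where ar: "a * r = - k" "r = k + a\<^sup>2 - a"
    and disc: "((a - 1)\<^sup>2 - 4 * r) * (a\<^sup>2 + (a - 1) * a + r)\<^sup>2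
      = - 4 * k * ((k - kappa_minus) * (k - kappa_plus))"
    by (rule glick_cubic_split)
  define D where "D = (a - 1)\<^sup>2 - 4 * r"
  have "- 4 * k * ((k - kappa_minus) * (k - kappa_plus)) < 0"
    using assms kappa_plus_minus(2,3)
    by (auto simp: mult_less_0_iff zero_less_mult_iff)
  with disc have "D * (a\<^sup>2 + (a - 1) * a + r)\<^sup>2 < 0"
    by (simp add: D_def)
  then have D: "D < 0"
    by (auto simp: mult_less_0_iff)
  \<comment> \<open>A quadratic factor without real roots has a positive constant term, which will
    be the squared modulus of \<open>z\<close>.\<close>
  then have r: "r > 0"
    using zero_le_power2[of "a - 1"] unfolding D_def by linarith
  define z where "z = Complex ((1 - a) / 2) (sqrt (- D) / 2)"
  have sq: "sqrt (- D) * sqrt (- D) = 4 * r - (a - 1)\<^sup>2"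
    using D by (simp add: D_def)
  have zz: "z * cnj z = of_real r"
    using sq by (simp add: z_def complex_eq_iff power2_eq_square field_simps)
  have zs: "z + cnj z = of_real (1 - a)"
    by (simp add: z_def complex_eq_iff)
  have cz: "cmod z = sqrt r"
    using zz by (simp add: complex_mod_sqrt_Re_mult_cnj)
  have "of_real a + z + cnj z = 1"
    using zs by (simp add: add.assoc)
  moreover have "of_real a * z + z * cnj z + cnj z * of_real a = of_real k"
  proof -
    have "of_real a * z + z * cnj z + cnj z * of_real a = of_real a * (z + cnj z) + z * cnj z"
      by (simp add: algebra_simps)
    also have "\<dots> = of_real (a * (1 - a) + r)"
      by (simp add: zs zz)
    also have "a * (1 - a) + r = k"
      using ar by (simp add: algebra_simps power2_eq_square)
    finally show ?thesis .
  qed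
  moreover have "of_real a * z * cnj z = - of_real k"
    using ar(1) by (simp add: mult.assoc zz flip: of_real_mult of_real_minus)
  ultimately have "proots (map_poly complex_of_real (glick_cubic k)) = {#of_real a, z, cnj z#}"
    by (rule proots_glick_cubic)
  moreover have "Im z \<noteq> 0"
    using D by (simp add: z_def)
  \<comment> \<open>From \<open>a * r = - k\<close> and \<open>r > 0\<close>, the signs of
    \<open>a\<close> and \<open>k\<close> are opposite, so \<open>a * (a - k)\<close> is positive.
    Dividing by \<open>a\<close> then compares \<open>a\<^sup>2\<close> with \<open>r\<close>; in
    the other case, \<open>k > 0\<close>, the negative \<open>a\<close> reverses the
    inequality.\<close>
  moreover have "cmod z < \<bar>a\<bar>" if "k < 0"
  proof -
    have "a > 0"
      using ar(1) r that by (smt (verit) mult_nonneg_nonneg mult_nonpos_nonneg)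
    with that have "a * (a - k) > 0"
      by simp
    also have "a * (a - k) = a * (a\<^sup>2 - r)"
      using ar by algebra
    finally have "a * (a\<^sup>2 - r) > 0" .
    with \<open>a > 0\<close> have "r < a\<^sup>2"
      by (simp add: zero_less_mult_iff)
    then show ?thesis
      using cz \<open>a > 0\<close> by (simp add: real_less_lsqrt)
  qed
  moreover have "\<bar>a\<bar> < cmod z" if "k > 0"
  proof -
    have "a < 0"
      using ar(1) r that by (smt (verit) mult_nonneg_nonneg mult_nonpos_nonneg)
    with that have "a * (a - k) > 0"
      by (simp add: zero_less_mult_iff)
    also have "a * (a - k) = a * (a\<^sup>2 - r)"
      using ar by algebra
    finally have "a * (a\<^sup>2 - r) > 0" .
    with \<open>a < 0\<close> have "a\<^sup>2 < r"
      by (simp add: zero_less_mult_iff)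
    then show ?thesis
      using cz by (simp add: real_less_rsqrt)
  qed
  ultimately show thesis
    using that by blast
qed

lemma glick_cubic_spectrum_0: "proots (map_poly complex_of_real (glick_cubic 0)) = {#1, 0, 0#}"
  by (rule proots_glick_cubic) simp_all

lemma inverse_golden: "inverse golden = (sqrt 5 - 1) / 2"
proof -
  have "golden * ((sqrt 5 - 1) / 2) = 1"
    by (simp add: golden_def field_simps)
  then show ?thesis
    by (rule inverse_unique)
qed

text \<open>\<open>2 + sqrt 5 = golden ^ 3\<close> and \<open>- kappa_minus = golden ^ 5\<close>, so
  the roots are \<open>golden ^ 3\<close> and twice \<open>- golden\<close>.\<close>

lemma glick_cubic_spectrum_kappa_minus:
  "proots (map_poly complex_of_real (glick_cubic kappa_minus)) =
     {#of_real (2 + sqrt 5), of_real (- golden), of_real (- golden)#}"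
proof (rule proots_glick_cubic_of_real)
  show "(2 + sqrt 5) + - golden + - golden = 1"
    "(2 + sqrt 5) * - golden + - golden * - golden + - golden * (2 + sqrt 5) = kappa_minus"
    "(2 + sqrt 5) * - golden * - golden = - kappa_minus"
    by (simp_all add: golden_def kappa_minus_def field_simps)
qed

text \<open>The Galois conjugate of the previous case: changing the sign of \<open>sqrt 5\<close>
  swaps \<open>kappa_minus\<close> with \<open>kappa_plus\<close> and \<open>- golden\<close> with
  \<open>inverse golden\<close>.\<close>

lemma glick_cubic_spectrum_kappa_plus:
  "proots (map_poly complex_of_real (glick_cubic kappa_plus)) =
     {#of_real (2 - sqrt 5), of_real (inverse golden), of_real (inverse golden)#}"
proof (rule proots_glick_cubic_of_real)
  show "(2 - sqrt 5) + inverse golden + inverse golden = 1"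
    "(2 - sqrt 5) * inverse golden + inverse golden * inverse golden + inverse golden * (2 - sqrt 5)
      = kappa_plus"
    "(2 - sqrt 5) * inverse golden * inverse golden = - kappa_plus"
    unfolding inverse_golden kappa_plus_def by (simp_all add: field_simps)
qed

section \<open>Characteristic polynomial and invariants of an arbitrary pentagon\<close>

lemma G_op_invariants:
  assumes "glick_domain P"
  defines "A \<equiv> matrix (G_op P)"
  shows "trace A = 1" "trace (A ** A) = 1 - 2 * kappa P" "det A = - kappa P"
proof -
  obtain M b c d e where M: "invertible M"
    and lift: "homogeneous_lift (\<lambda>i. M *v std_pentagon b c d e i) P"
    and ne: "e - b * d \<noteq> 0" "b - c * e \<noteq> 0"
    using assms(1) by (rule glick_domain_std_pentagon)
  have A: "A = glick_matrix (\<lambda>i. M *v std_pentagon b c d e i)"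
    unfolding A_def by (rule matrix_G_op[OF lift])
  have "det M \<noteq> 0"
    using M invertible_det_nz by blast
  then have "kappa P = kappa_num (std_pentagon b c d e) / kappa_den (std_pentagon b c d e)"
    by (simp add: kappa_eq[OF lift] kappa_num_def kappa_den_def bracket_def det3_matrix_mult)
  then have kappa: "kappa P = b * c * d * e * (c * d - 1) / - ((e - b * d) * (b - c * e))"
    by (simp only: kappa_std_pentagon)
  show "trace A = 1" "trace (A ** A) = 1 - 2 * kappa P" "det A = - kappa P"
    using similar_invariants[OF M glick_matrix_projective[OF M]] invariants_std_pentagon[OF ne]
    unfolding A kappa by simp_all
qed

lemma charpoly_G_op: "glick_domain P \<Longrightarrow> charpoly (matrix (G_op P)) = glick_cubic (kappa P)"
  by (simp add: charpoly_3 G_op_invariants glick_cubic_def)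

lemma spectrum_G_op:
  "glick_domain P \<Longrightarrow> spectrum (matrix (G_op P)) = proots (map_poly complex_of_real (glick_cubic (kappa P)))"
  by (simp add: spectrum_def charpoly_G_op)

text \<open>This is minus the characteristic polynomial at \<open>c\<close>, written through the
  same three invariants.\<close>

lemma det_minus_scalar_3:
  fixes A :: "real^3^3"
  shows "det (A - mat c) = det A - c * ((trace A)\<^sup>2 - trace (A ** A)) / 2 + c\<^sup>2 * trace A - c ^ 3"
  by (simp add: det_3 mat_def trace_3 matrix_matrix_mult_def sum_3 power2_eq_square power3_eq_cube
      field_simps)

lemma trace_minus_scalar_3:
  fixes A :: "real^3^3"
  shows "trace ((A - mat c) ** (A - mat c)) = trace (A ** A) - 2 * c * trace A + 3 * c\<^sup>2"
  by (simp add: mat_def trace_3 matrix_matrix_mult_def sum_3 power2_eq_square algebra_simps)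

lemma S5_eq: "glick_domain P \<Longrightarrow> S5 P = 1/3 - kappa P"
  by (simp add: S5_def matrix_compose linear_L_hat matrix_L_hat trace_minus_scalar_3 G_op_invariants
      power2_eq_square)

lemma R5_eq: "glick_domain P \<Longrightarrow> R5 P = 2/27 - 4/3 * kappa P"
  by (simp add: R5_def matrix_L_hat det_minus_scalar_3 G_op_invariants power2_eq_square power3_eq_cube
      field_simps)

section \<open>Convex pentagons\<close>

text \<open>For \<open>h = 0\<close> the left side touches zero at its minimum
  \<open>inverse golden\<close>, hence the squared factor; the terms containing \<open>h\<close>
  collect into the second summand.\<close>

lemma convex_pentagon_bound_aux:
  fixes g h :: real
  assumes "g > 0" "h \<ge> 0"
  shows "((1 + g)\<^sup>2 + h) * (g * (2 + g) + h) + kappa_minus * g\<^sup>2 =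
    g * (g - inverse golden)\<^sup>2 * (g + 3 + sqrt 5) + h * ((1 + g)\<^sup>2 + g * (2 + g) + h)"
proof -
  have "sqrt 5 * sqrt 5 = 5"
    by simp
  then show ?thesis
    unfolding inverse_golden kappa_minus_def by (simp add: field_simps power2_eq_square)
qed

lemma convex_pentagon_bound:
  fixes s w :: real
  assumes "s > 0" "w > 0"
  shows "(1 + s) * (1 + w) * (s + w + s * w) / (s * w) \<ge> - kappa_minus"
    and "(1 + s) * (1 + w) * (s + w + s * w) / (s * w) = - kappa_minus \<Longrightarrow>
      s = inverse golden \<and> w = inverse golden"
proof -
  let ?K = "(1 + s) * (1 + w) * (s + w + s * w) / (s * w)"
  \<comment> \<open>By AM-GM the symmetric case \<open>s = w = g\<close> is extremal; \<open>h\<close> measures the deviation from it.\<close>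
  define g where "g = sqrt s * sqrt w"
  define h where "h = (sqrt s - sqrt w)\<^sup>2"
  have g: "g > 0" "g\<^sup>2 = s * w" and sw: "s + w = 2 * g + h"
    using assms by (simp_all add: g_def h_def power2_diff power_mult_distrib)
  have h: "h \<ge> 0"
    by (simp add: h_def)
  define A where "A = g * (g - inverse golden)\<^sup>2 * (g + 3 + sqrt 5)"
  define B where "B = h * ((1 + g)\<^sup>2 + g * (2 + g) + h)"
  have "(1 + s) * (1 + w) * (s + w + s * w) = ((1 + g)\<^sup>2 + h) * (g * (2 + g) + h)"
  proof -
    have "(1 + s) * (1 + w) = 1 + (s + w) + s * w"
      by (simp add: algebra_simps)
    then show ?thesis
      by (simp add: sw flip: g(2)) (simp add: algebra_simps power2_eq_square)
  qed
  then have eq: "(1 + s) * (1 + w) * (s + w + s * w) + kappa_minus * (s * w) = A + B"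
    using convex_pentagon_bound_aux[OF g(1) h] by (simp add: A_def B_def g(2))
  have pos: "g + 3 + sqrt 5 > 0" "(1 + g)\<^sup>2 + g * (2 + g) + h > 0"
    using g(1) h by (simp_all add: add_pos_pos add_pos_nonneg)
  then have A: "A \<ge> 0" and B: "B \<ge> 0"
    using g(1) h by (simp_all add: A_def B_def)
  have K: "?K + kappa_minus = (A + B) / (s * w)"
    using assms by (simp flip: eq add: add_divide_distrib)
  have "(A + B) / (s * w) \<ge> 0"
    using A B assms by simp
  with K show "?K \<ge> - kappa_minus"
    by linarith
  assume "?K = - kappa_minus"
  with K assms have "A + B = 0"
    by simp
  with A B have "A = 0" "B = 0"
    by linarith+
  \<comment> \<open>The cofactors in \<open>pos\<close> and \<open>g\<close> are positive, so
    \<open>A = 0\<close> kills the square and \<open>B = 0\<close> kills \<open>h\<close>, which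
    means \<open>s = w\<close>.\<close>
  then have "g = inverse golden" "h = 0"
    using g(1) pos by (auto simp: A_def B_def)
  then have "sqrt s = sqrt w"
    by (simp add: h_def)
  then have "s = w"
    by simp
  with g(2) assms have "g = s"
    by (simp add: g_def)
  with \<open>g = inverse golden\<close> \<open>s = w\<close> show "s = inverse golden \<and> w = inverse golden"
    by simp
qed

text \<open>Convexity at the level of lifts: each directed edge has all other vertices on its
  positive side. It depends on the lift, since changing the sign of one vector flips
  brackets.\<close>

definition positively_oriented :: "(5 \<Rightarrow> real^3) \<Rightarrow> bool" where
  "positively_oriented q \<longleftrightarrow> (\<forall>i j. j \<noteq> i \<longrightarrow> j \<noteq> i + 1 \<longrightarrow> 0 < det3 (q i) (q (i + 1)) (q j))"

lemma positively_oriented_glick_domain: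
  assumes "positively_oriented q" "homogeneous_lift q P"
  shows "glick_domain P"
proof -
  have "i + 1 \<noteq> i - 1" for i :: 5
    using exhaust_5[of i] by (auto simp: numeral_mod_5)
  then have "0 < det3 (q (i - 1)) (q (i - 1 + 1)) (q (i + 1))" for i
    using assms(1)[unfolded positively_oriented_def, rule_format, of "i + 1" "i - 1"] by simp
  then show ?thesis
    by (simp add: glick_domain_iff[OF assms(2)] less_imp_neq[symmetric])
qed

text \<open>The frame scalings still free in the general normal form are spent on making
  \<open>b\<close> and \<open>e\<close> equal to \<open>- 1\<close>. Two parameters remain, and
  positivity of \<open>[345]\<close> and \<open>[451]\<close> becomes \<open>s > 0\<close> and
  \<open>w > 0\<close>.\<close>

lemma positively_oriented_std_pentagon:
  assumes pos: "positively_oriented q" and q: "homogeneous_lift q P"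
  obtains M s w where "invertible M" "s > 0" "w > 0"
    "homogeneous_lift (\<lambda>i. M *v std_pentagon (- 1) (1 + w) (1 + s) (- 1) i) P"
proof -
  have pos': "0 < det3 (q i) (q (i + 1)) (q j)" if "j \<noteq> i" "j \<noteq> i + 1" for i j
    using pos that by (auto simp: positively_oriented_def)
  define D where "D = det3 (q 1) (q 2) (q 3)"
  have D: "D > 0"
    using pos'[of 3 1] by (simp add: D_def)
  then have D0: "det3 (q 1) (q 2) (q 3) \<noteq> 0"
    by (simp add: D_def)
  obtain a b c where q4: "q 4 = a *\<^sub>R q 1 + b *\<^sub>R q 2 + c *\<^sub>R q 3"
    using det3_coordinates[OF D0] by blast
  obtain d e f where q0: "q 0 = d *\<^sub>R q 1 + e *\<^sub>R q 2 + f *\<^sub>R q 3"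
    using det3_coordinates[OF D0] by blast
  \<comment> \<open>Each bracket reads off a coordinate of \<open>q 4\<close> or \<open>q 0\<close>,
    or a 2 by 2 minor of the two.\<close>
  have "det3 (q 2) (q 3) (q 4) = a * D" "det3 (q 3) (q 4) (q 1) = - b * D"
    "det3 (q 0) (q 1) (q 3) = - e * D" "det3 (q 0) (q 1) (q 2) = f * D"
    "det3 (q 3) (q 4) (q 0) = (a * e - b * d) * D" "det3 (q 4) (q 0) (q 1) = (b * f - c * e) * D"
    unfolding q4 q0 D_def by (simp_all add: det3_expand algebra_simps)
  with D pos'[of 4 2] pos'[of 1 3] pos'[of 3 0] pos'[of 2 0] pos'[of 0 3] pos'[of 1 4]
  have signs: "a > 0" "b < 0" "e < 0" "f > 0" "a * e - b * d > 0" "b * f - c * e > 0"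
    by (simp_all add: numeral_mod_5 zero_less_mult_iff mult_less_0_iff)
  define s where "s = (d * b - e * a) / (e * a)"
  define w where "w = (c * e - f * b) / (f * b)"
  have "e * a < 0" "f * b < 0"
    using signs by (simp_all add: mult_less_0_iff)
  then have "s > 0" "w > 0"
    using signs unfolding s_def w_def by (auto intro!: divide_neg_neg simp: algebra_simps)
  \<comment> \<open>The factors \<open>a\<close> and \<open>- b\<close> turn the first two
    coordinates of \<open>q 4\<close> into 1 and \<open>- 1\<close>; scaling \<open>q 0\<close> by
    \<open>b / e\<close> gives it the second coordinate \<open>- 1\<close>, and its third coordinate
    then forces \<open>f * b / e\<close>.\<close>
  moreover have "invertible (frame (a *\<^sub>R q 1) (- b *\<^sub>R q 2) ((f * b / e) *\<^sub>R q 3))"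
    using signs D0 by (simp only: invertible_frame det3_scale) auto
  moreover have "homogeneous_lift (\<lambda>i. frame (a *\<^sub>R q 1) (- b *\<^sub>R q 2) ((f * b / e) *\<^sub>R q 3)
      *v std_pentagon (- 1) (1 + w) (1 + s) (- 1) i) P"
  proof (rule homogeneous_lift_std_pentagon[OF q, where ?m4.0 = 1 and ?m0.0 = "b / e"])
    have "(1 + w) * (f * b / e) = c" "(1 + s) * a = b / e * d"
      using signs by (simp_all add: s_def w_def field_simps)
    then show "1 *\<^sub>R q 4 = a *\<^sub>R q 1 + (- 1 * - b) *\<^sub>R q 2 + ((1 + w) * (f * b / e)) *\<^sub>R q 3"
      "(b / e) *\<^sub>R q 0 = ((1 + s) * a) *\<^sub>R q 1 + (- 1 * - b) *\<^sub>R q 2 + (f * b / e) *\<^sub>R q 3"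
      using signs by (simp_all only: q4 q0 scaleR_add_right scaleR_scaleR) (simp_all add: mult.commute)
  qed (use signs in auto)
  ultimately show thesis
    using that by blast
qed

lemma kappa_convex_std_pentagon:
  assumes "invertible M" "homogeneous_lift (\<lambda>i. M *v std_pentagon (- 1) (1 + w) (1 + s) (- 1) i) P"
  shows "kappa P = - ((1 + s) * (1 + w) * (s + w + s * w) / (s * w))"
proof -
  have "det M \<noteq> 0"
    using assms(1) invertible_det_nz by blast
  then have "kappa P = kappa_num (std_pentagon (- 1) (1 + w) (1 + s) (- 1))
      / kappa_den (std_pentagon (- 1) (1 + w) (1 + s) (- 1))"
    by (simp add: kappa_eq[OF assms(2)] kappa_num_def kappa_den_def bracket_def det3_matrix_mult)
  also have "\<dots> = - ((1 + s) * (1 + w) * (s + w + s * w) / (s * w))"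
  proof -
    have "kappa_num (std_pentagon (- 1) (1 + w) (1 + s) (- 1)) = (1 + s) * (1 + w) * (s + w + s * w)"
      "kappa_den (std_pentagon (- 1) (1 + w) (1 + s) (- 1)) = - (s * w)"
      by (simp_all add: kappa_std_pentagon algebra_simps)
    then show ?thesis
      by simp
  qed
  finally show ?thesis .
qed

lemma positively_oriented_kappa_le:
  assumes "positively_oriented q" "homogeneous_lift q P"
  shows "kappa P \<le> kappa_minus"
proof -
  obtain M s w where M: "invertible M" "s > 0" "w > 0"
    "homogeneous_lift (\<lambda>i. M *v std_pentagon (- 1) (1 + w) (1 + s) (- 1) i) P"
    using positively_oriented_std_pentagon[OF assms] by blast
  then show ?thesis
    using convex_pentagon_bound(1)[of s w] kappa_convex_std_pentagon[OF M(1,4)] by simp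
qed

text \<open>Equality in the bound fixes both parameters, so all extremal pentagons share one normal
  form.\<close>

lemma positively_oriented_kappa_eq:
  assumes "positively_oriented q" "homogeneous_lift q P" "kappa P = kappa_minus"
  obtains M where "invertible M"
    "homogeneous_lift
      (\<lambda>i. M *v std_pentagon (- 1) (1 + inverse golden) (1 + inverse golden) (- 1) i) P"
proof -
  obtain M s w where M: "invertible M" "s > 0" "w > 0"
    "homogeneous_lift (\<lambda>i. M *v std_pentagon (- 1) (1 + w) (1 + s) (- 1) i) P"
    using positively_oriented_std_pentagon[OF assms(1,2)] by blast
  then have "s = inverse golden \<and> w = inverse golden"
    using assms(3) convex_pentagon_bound(2)[of s w] kappa_convex_std_pentagon[OF M(1,4)] by simp
  with M that show thesis
    by blast
qed

section \<open>Projective equivalence through a common normal form\<close>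

lemma projective_transformation_matrix:
  assumes "invertible A"
  obtains f where "projective_transformation f" "\<And>v. v \<noteq> 0 \<Longrightarrow> f (proj_pt v) = proj_pt (A *v v)"
proof -
  \<comment> \<open>The chosen representative is harmless: two of them differ by a nonzero factor,
    which \<open>A\<close> preserves.\<close>
  define f where "f p = proj_pt (A *v (SOME v. v \<noteq> 0 \<and> proj_pt v = p))" for p
  have f: "f (proj_pt v) = proj_pt (A *v v)" if v: "v \<noteq> 0" for v
  proof -
    define u where "u = (SOME u. u \<noteq> 0 \<and> proj_pt u = proj_pt v)"
    have u: "u \<noteq> 0 \<and> proj_pt u = proj_pt v"
      unfolding u_def by (rule someI[of _ v]) (use v in simp)
    then obtain c where c: "c \<noteq> 0" "v = c *\<^sub>R u"
      using proj_pt_eq_iff[of u v] u v by auto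
    have "A *v x \<noteq> 0" if "x \<noteq> 0" for x
      using assms that by (metis invertible_def matrix_vector_mul_assoc matrix_vector_mul_lid
          matrix_vector_mult_0_right)
    then have "proj_pt (A *v u) = proj_pt (A *v v)"
      using u v c proj_pt_eq_iff[of "A *v u" "A *v v"] by (auto simp: matrix_vector_mult_scaleR)
    then show ?thesis
      by (simp add: f_def u_def)
  qed
  then have "projective_transformation f"
    using assms unfolding projective_transformation_def by blast
  with f that show thesis
    by blast
qed

text \<open>The inverse of \<open>M\<close> followed by \<open>M'\<close> matches the vertices label
  by label.\<close>

lemma projectively_equivalent_common_lift:
  assumes "invertible M" "homogeneous_lift (\<lambda>i. M *v N i) P"
    and "invertible M'" "homogeneous_lift (\<lambda>i. M' *v N i) P'"
  obtains f where "projective_transformation f" "\<And>i. f (P i) = P' i"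
proof -
  obtain L where L: "L ** M = mat 1" "M ** L = mat 1"
    using assms(1) by (auto simp: invertible_def)
  then have "invertible (M' ** L)"
    using assms(3) by (meson invertible_def invertible_mult)
  then obtain f where f: "projective_transformation f"
    "\<And>v. v \<noteq> 0 \<Longrightarrow> f (proj_pt v) = proj_pt ((M' ** L) *v v)"
    using projective_transformation_matrix by blast
  have "f (P i) = P' i" for i
  proof -
    have "M *v N i \<noteq> 0" "proj_pt (M *v N i) = P i" "proj_pt (M' *v N i) = P' i"
      using assms(2,4) by (auto simp: homogeneous_lift_def)
    moreover have "(M' ** L) *v (M *v N i) = M' *v N i"
      by (metis L(1) matrix_mul_assoc matrix_mul_rid matrix_vector_mul_assoc)
    ultimately show ?thesis
      using f(2) by metis
  qed
  with f(1) that show thesis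
    by blast
qed

section \<open>Supporting lines and the orientation of a planar convex pentagon\<close>

definition affine_lift :: "real^2 \<Rightarrow> real^3" where
  "affine_lift x = vector [x $ 1, x $ 2, 1]"

lemma homogeneous_lift_affine: "homogeneous_lift (\<lambda>i. affine_lift (x i)) (affine_pt \<circ> x)"
proof -
  have "affine_lift y $ 3 \<noteq> 0" for y
    by (simp add: affine_lift_def)
  then have "affine_lift y \<noteq> 0" for y
    by (metis zero_index)
  then show ?thesis
    by (simp add: homogeneous_lift_def affine_pt_def affine_lift_def)
qed

text \<open>Each edge is exposed by a supporting line, and \<open>\<tau>\<close> is the side on which the others lie.\<close>

lemma strictly_convex_pentagon_edge:
  assumes "strictly_convex_pentagon x"
  obtains \<tau> where
    "\<And>j. j \<noteq> i \<Longrightarrow> j \<noteq> i + 1 \<Longrightarrow>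
      0 < \<tau> * det3 (affine_lift (x i)) (affine_lift (x (i + 1))) (affine_lift (x j))"
proof -
  define H where "H = convex hull (range x)"
  have inj: "inj x" and ext: "\<And>j. x j extreme_point_of H"
    and edge: "closed_segment (x i) (x (i + 1)) edge_of H"
    using assms by (auto simp: strictly_convex_pentagon_def H_def)
  \<comment> \<open>Every face of a polyhedron is exposed, which supplies the supporting line
    \<open>a \<bullet> y = b\<close> of the edge.\<close>
  have "polyhedron H"
    unfolding H_def by (simp add: polyhedron_convex_hull)
  then have "closed_segment (x i) (x (i + 1)) exposed_face_of H"
    using edge by (simp add: edge_of_def exposed_face_of_polyhedron)
  then obtain a b where ab: "H \<subseteq> {y. a \<bullet> y \<le> b}"
    "closed_segment (x i) (x (i + 1)) = H \<inter> {y. a \<bullet> y = b}"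
    unfolding exposed_face_of_def by blast
  have xH: "x j \<in> H" for j
    by (simp add: H_def hull_inc)
  have e: "a \<bullet> x i = b" "a \<bullet> x (i + 1) = b"
    using ab(2) ends_in_segment by blast+
  define y where "y = x (i + 1) - x i"
  have y: "a \<bullet> y = 0"
    by (simp add: y_def inner_diff_right e)
  define \<tau> where "\<tau> = a $ 1 * y $ 2 - a $ 2 * y $ 1"
  show thesis
  proof (rule that[of \<tau>])
    fix j assume j: "j \<noteq> i" "j \<noteq> i + 1"
    have "x j \<notin> closed_segment (x i) (x (i + 1))"
    proof
      assume "x j \<in> closed_segment (x i) (x (i + 1))"
      moreover have "x j \<noteq> x i" "x j \<noteq> x (i + 1)"
        using j inj by (auto dest: injD)
      ultimately have "x j \<in> open_segment (x i) (x (i + 1))"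
        by (simp add: open_segment_def)
      then show False
        using ext[of j] xH unfolding extreme_point_of_def by blast
    qed
    then have lt: "a \<bullet> x j < b"
      using ab xH[of j] by fastforce
    define z where "z = x j - x i"
    have z: "a \<bullet> z < 0"
      using lt e by (simp add: z_def inner_diff_right)
    have "y \<noteq> 0"
      using inj unfolding y_def by (auto dest: injD)
    then have "(y \<bullet> y) * (a \<bullet> z) < 0"
      using z by (simp add: mult_less_0_iff)
    \<comment> \<open>Since \<open>a\<close> is orthogonal to \<open>y\<close>, it is
      \<open>\<tau> / (y \<bullet> y)\<close> times \<open>y\<close> turned by a right angle. The
      bracket below is twice a signed triangle area.\<close>
    moreover have "(y \<bullet> y) * (a \<bullet> z) = \<tau> * (z $ 1 * y $ 2 - z $ 2 * y $ 1)"
      using y unfolding \<tau>_def inner_vec_def sum_2 inner_real_def by algebra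
    moreover have "det3 (affine_lift (x i)) (affine_lift (x (i + 1))) (affine_lift (x j))
        = - (z $ 1 * y $ 2 - z $ 2 * y $ 1)"
      by (simp add: det3_expand affine_lift_def z_def y_def algebra_simps)
    ultimately show "0 < \<tau> * det3 (affine_lift (x i)) (affine_lift (x (i + 1))) (affine_lift (x j))"
      by (simp add: right_diff_distrib)
  qed
qed

text \<open>Adjacent edges share the triangle \<open>i\<close>, \<open>i + 1\<close>,
  \<open>i + 2\<close>, so their sides agree, and the sign propagates around the pentagon.\<close>

lemma strictly_convex_pentagon_oriented:
  assumes "strictly_convex_pentagon x"
  obtains q where "positively_oriented q" "homogeneous_lift q (affine_pt \<circ> x)"
proof -
  define p where "p i = affine_lift (x i)" for i
  have "\<exists>\<tau>. \<forall>j. j \<noteq> i \<longrightarrow> j \<noteq> i + 1 \<longrightarrow> 0 < \<tau> * det3 (p i) (p (i + 1)) (p j)" for i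
    using strictly_convex_pentagon_edge[OF assms, of i] unfolding p_def by metis
  then obtain \<tau> where \<tau>: "\<And>i j. j \<noteq> i \<Longrightarrow> j \<noteq> i + 1 \<Longrightarrow> 0 < \<tau> i * det3 (p i) (p (i + 1)) (p j)"
    by metis
  have step: "sgn (\<tau> (i + 1)) = sgn (\<tau> i)" for i
  proof -
    have "det3 (p (i + 1)) (p (i + 2)) (p i) = det3 (p i) (p (i + 1)) (p (i + 2))"
      by (simp add: det3_expand algebra_simps)
    moreover have "0 < \<tau> i * det3 (p i) (p (i + 1)) (p (i + 2))"
      using \<tau>[of "i + 2" i] by simp
    moreover have "0 < \<tau> (i + 1) * det3 (p (i + 1)) (p (i + 2)) (p i)"
      using \<tau>[of i "i + 1"] by (simp add: add.assoc)
    ultimately show ?thesis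
      by (auto simp: zero_less_mult_iff)
  qed
  have const: "sgn (\<tau> i) = sgn (\<tau> 0)" for i
    using exhaust_5[of i] step[of 0] step[of 1] step[of 2] step[of 3] by auto
  have "0 < \<tau> 0 * det3 (p 0) (p 1) (p 2)"
    using \<tau>[of 2 0] by simp
  then have \<tau>0: "\<tau> 0 \<noteq> 0"
    by auto
  \<comment> \<open>Scaling all lifts by a sign multiplies each bracket by its cube, which is the
    sign itself.\<close>
  define q where "q i = sgn (\<tau> 0) *\<^sub>R p i" for i
  have "homogeneous_lift q (affine_pt \<circ> x)"
    unfolding q_def p_def using \<tau>0 by (intro homogeneous_lift_rescale homogeneous_lift_affine) (simp add: sgn_zero_iff)
  moreover have "positively_oriented q"
    unfolding positively_oriented_def
  proof (intro allI impI)
    fix i j :: 5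
    assume "j \<noteq> i" "j \<noteq> i + 1"
    then have "0 < \<tau> i * det3 (p i) (p (i + 1)) (p j)"
      by (rule \<tau>)
    then have "0 < sgn (\<tau> i) * det3 (p i) (p (i + 1)) (p j)"
      by (auto simp: zero_less_mult_iff)
    then show "0 < det3 (q i) (q (i + 1)) (q j)"
      using const[of i] \<tau>0 by (auto simp: q_def det3_scale sgn_if split: if_splits)
  qed
  ultimately show thesis
    using that by blast
qed

section \<open>The regular pentagon\<close>

text \<open>The angles \<open>6 * pi / 5\<close> and \<open>4 * pi / 5\<close> have equal cosines.
  Equating the triple and double angle formulas gives a cubic for \<open>C\<close> with the spurious
  root 1; positivity selects the right root of the quadratic that remains.\<close>

lemma cos_sin_72:
  defines "C \<equiv> cos (2 * pi / 5)" and "S \<equiv> sin (2 * pi / 5)"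
  shows "C = (sqrt 5 - 1) / 4" "S > 0"
    "cos (4 * pi / 5) = - (sqrt 5 + 1) / 4" "sin (4 * pi / 5) = S * (sqrt 5 - 1) / 2"
    "cos (6 * pi / 5) = - (sqrt 5 + 1) / 4" "sin (6 * pi / 5) = - (S * (sqrt 5 - 1) / 2)"
    "cos (8 * pi / 5) = C" "sin (8 * pi / 5) = - S"
proof -
  have reflect: "cos (6 * pi / 5) = cos (4 * pi / 5)" "sin (6 * pi / 5) = - sin (4 * pi / 5)"
    "cos (8 * pi / 5) = C" "sin (8 * pi / 5) = - S"
  proof -
    have "6 * pi / 5 = 2 * pi - 4 * pi / 5" "8 * pi / 5 = 2 * pi - 2 * pi / 5"
      by (simp_all add: field_simps)
    then show "cos (6 * pi / 5) = cos (4 * pi / 5)" "sin (6 * pi / 5) = - sin (4 * pi / 5)"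
      "cos (8 * pi / 5) = C" "sin (8 * pi / 5) = - S"
      by (simp_all only: cos_2pi_minus sin_2pi_minus C_def S_def)
  qed
  have double: "cos (4 * pi / 5) = 2 * C\<^sup>2 - 1" "sin (4 * pi / 5) = 2 * S * C"
    using cos_double_cos[of "2 * pi / 5"] sin_double[of "2 * pi / 5"] by (simp_all add: C_def S_def)
  have "cos (6 * pi / 5) = 4 * C ^ 3 - 3 * C"
    using cos_treble_cos[of "2 * pi / 5"] by (simp add: C_def)
  with reflect(1) double(1) have "(C - 1) * (4 * C\<^sup>2 + 2 * C - 1) = 0"
    by (simp add: algebra_simps power2_eq_square power3_eq_cube)
  moreover have "C < 1" "C > 0"
    using cos_monotone_0_pi[of 0 "2 * pi / 5"] cos_gt_zero[of "2 * pi / 5"] pi_gt_zero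
    by (simp_all add: C_def)
  ultimately have C4: "4 * C\<^sup>2 + 2 * C - 1 = 0"
    by simp
  then have C2: "C\<^sup>2 = 1 / 4 - C / 2"
    by simp
  from C4 have "(4 * C + 1)\<^sup>2 = 5"
    by (simp add: power2_eq_square algebra_simps)
  then have "4 * C + 1 = sqrt 5"
    using \<open>C > 0\<close> by (simp add: real_sqrt_unique)
  then show C: "C = (sqrt 5 - 1) / 4"
    by simp
  show "S > 0"
    using pi_gt_zero unfolding S_def by (intro sin_gt_zero) auto
  show "cos (4 * pi / 5) = - (sqrt 5 + 1) / 4" "sin (4 * pi / 5) = S * (sqrt 5 - 1) / 2"
    unfolding double C2 by (simp_all add: C field_simps)
  then show "cos (6 * pi / 5) = - (sqrt 5 + 1) / 4" "sin (6 * pi / 5) = - (S * (sqrt 5 - 1) / 2)"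
    "cos (8 * pi / 5) = C" "sin (8 * pi / 5) = - S"
    by (simp_all add: reflect)
qed

text \<open>Labels run one ahead of vertex numbers, and label 5 is the index 0, hence the final
  case.\<close>

definition regular_pentagon :: "5 \<Rightarrow> real^2" where
  "regular_pentagon i = regular_vertex
     (if i = 1 then 0 else if i = 2 then 1 else if i = 3 then 2 else if i = 4 then 3 else 4)"

lemma projectively_regular_iff:
  "projectively_regular P \<longleftrightarrow>
     (\<exists>f. projective_transformation f \<and> f \<circ> P = affine_pt \<circ> regular_pentagon)"
proof -
  have "(\<forall>j<5. f (P (of_nat j + 1)) = affine_pt (regular_vertex j)) \<longleftrightarrow>
      f \<circ> P = affine_pt \<circ> regular_pentagon" for f
    unfolding fun_eq_iff forall_5
    by (auto simp: eval_nat_numeral less_Suc_eq all_simps numeral_mod_5 regular_pentagon_def)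
  then show ?thesis
    by (simp add: projectively_regular_def)
qed

lemma affine_lift_regular_pentagon:
  defines "S \<equiv> sin (2 * pi / 5)"
  shows "affine_lift (regular_pentagon 0) = vector [(sqrt 5 - 1) / 4, - S, 1]"
    "affine_lift (regular_pentagon 1) = vector [1, 0, 1]"
    "affine_lift (regular_pentagon 2) = vector [(sqrt 5 - 1) / 4, S, 1]"
    "affine_lift (regular_pentagon 3) = vector [- (sqrt 5 + 1) / 4, S * (sqrt 5 - 1) / 2, 1]"
    "affine_lift (regular_pentagon 4) = vector [- (sqrt 5 + 1) / 4, - (S * (sqrt 5 - 1) / 2), 1]"
  by (simp_all add: regular_pentagon_def regular_vertex_def affine_lift_def S_def cos_sin_72)

text \<open>Rotational symmetry makes both cyclic families of brackets constant, so
  \<open>kappa\<close> becomes a fifth power of one ratio.\<close>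

lemma regular_pentagon_brackets:
  fixes i :: 5
  defines "q \<equiv> \<lambda>i. affine_lift (regular_pentagon i)" and "S \<equiv> sin (2 * pi / 5)"
  shows "det3 (q (i - 1)) (q i) (q (i + 1)) = S * (5 - sqrt 5) / 2"
    "det3 (q i) (q (i + 2)) (q (i + 3)) = S * sqrt 5"
proof -
  have sqrt5: "sqrt 5 * (sqrt 5 * a) = 5 * a" for a :: real
    by (simp flip: mult.assoc)
  show "det3 (q (i - 1)) (q i) (q (i + 1)) = S * (5 - sqrt 5) / 2"
    "det3 (q i) (q (i + 2)) (q (i + 3)) = S * sqrt 5"
    using exhaust_5[of i]
    by (auto simp: q_def numeral_mod_5 affine_lift_regular_pentagon[folded S_def] det3_expand
        field_simps sqrt5)
qed

lemma positively_oriented_regular_pentagon: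
  "positively_oriented (\<lambda>i. affine_lift (regular_pentagon i))" (is "positively_oriented ?q")
  unfolding positively_oriented_def
proof (intro allI impI)
  fix i j :: 5
  assume "j \<noteq> i" "j \<noteq> i + 1"
  then have "j = i + 2 \<or> j = i + 3 \<or> j = i + 4"
    using exhaust_5[of i] exhaust_5[of j] by (auto simp: numeral_mod_5)
  moreover have "sqrt 5 < 5"
    by (rule real_less_lsqrt) auto
  then have "0 < det3 (?q (i - 1)) (?q i) (?q (i + 1))" "0 < det3 (?q i) (?q (i + 2)) (?q (i + 3))" for i
    using cos_sin_72(2) by (simp_all add: regular_pentagon_brackets)
  \<comment> \<open>A third vertex next to the edge gives a consecutive triple, and the opposite
    vertex \<open>i + 3\<close> gives the other family.\<close>
  from this(1)[of "i + 1"] this(1)[of i] this(2)[of "i + 3"]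
  have "0 < det3 (?q i) (?q (i + 1)) (?q (i + 2))" "0 < det3 (?q (i + 4)) (?q i) (?q (i + 1))"
    "0 < det3 (?q (i + 3)) (?q i) (?q (i + 1))"
    using exhaust_5[of i] by (auto simp: numeral_mod_5)
  moreover have "det3 u v w = det3 v w u" for u v w
    by (simp add: det3_expand algebra_simps)
  ultimately show "0 < det3 (?q i) (?q (i + 1)) (?q j)"
    by metis
qed

lemma kappa_regular_pentagon: "kappa (affine_pt \<circ> regular_pentagon) = kappa_minus"
proof -
  define S where "S = sin (2 * pi / 5)"
  have S: "S > 0"
    unfolding S_def by (rule cos_sin_72)
  have "kappa (affine_pt \<circ> regular_pentagon) = - ((S * sqrt 5) ^ 5 / (S * (5 - sqrt 5) / 2) ^ 5)"
    by (simp add: kappa_eq[OF homogeneous_lift_affine] kappa_num_eq_prod kappa_den_eq_prod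
        regular_pentagon_brackets S_def)
  also have "\<dots> = - (((S * sqrt 5) / (S * (5 - sqrt 5) / 2)) ^ 5)"
    by (simp only: power_divide)
  also have "(S * sqrt 5) / (S * (5 - sqrt 5) / 2) = golden"
  proof -
    have "sqrt 5 < 5"
      by (rule real_less_lsqrt) auto
    then show ?thesis
      using S by (simp add: golden_def field_simps)
  qed
  also have "golden ^ 5 = - kappa_minus"
    by (simp add: golden_def kappa_minus_def power_def numeral_eq_Suc field_simps)
  finally show ?thesis
    by (simp only: minus_minus)
qed

text \<open>An extremal \<open>P\<close> and the regular pentagon, itself positively oriented and
  extremal, have the same normal form; the converse is projective invariance.\<close>

lemma positively_oriented_regular_iff:
  assumes "positively_oriented q" "homogeneous_lift q P"
  shows "kappa P = kappa_minus \<longleftrightarrow> projectively_regular P"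
proof
  assume "kappa P = kappa_minus"
  then obtain M where M: "invertible M" "homogeneous_lift
      (\<lambda>i. M *v std_pentagon (- 1) (1 + inverse golden) (1 + inverse golden) (- 1) i) P"
    using positively_oriented_kappa_eq[OF assms] by blast
  obtain M' where M': "invertible M'" "homogeneous_lift
      (\<lambda>i. M' *v std_pentagon (- 1) (1 + inverse golden) (1 + inverse golden) (- 1) i)
      (affine_pt \<circ> regular_pentagon)"
    using positively_oriented_kappa_eq[OF positively_oriented_regular_pentagon
        homogeneous_lift_affine kappa_regular_pentagon] by blast
  show "projectively_regular P"
    unfolding projectively_regular_iff
    using projectively_equivalent_common_lift[OF M M'] by (metis (no_types, lifting) comp_apply ext)
next
  assume "projectively_regular P"
  then show "kappa P = kappa_minus"
    unfolding projectively_regular_iff by (metis kappa_projective kappa_regular_pentagon)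
qed

theorem theorem5p16:
  shows
   "(\<forall>P :: 5 \<Rightarrow> rp2. glick_domain P \<longrightarrow>
       (\<forall>q. homogeneous_lift q P \<longrightarrow>
          kappa_den q \<noteq> 0 \<and> kappa_num q / kappa_den q = kappa P) \<and>
       (\<forall>f. projective_transformation f \<longrightarrow>
          glick_domain (f \<circ> P) \<and> kappa (f \<circ> P) = kappa P) \<and>
       (\<forall>s. glick_domain (relabel s P) \<and> kappa (relabel s P) = kappa P) \<and>
       kappa P = - det (matrix (G_op P)) \<and>
       charpoly (matrix (G_op P)) = [:kappa P, kappa P, -1, 1:] \<and>
       (\<forall>Q. glick_domain Q \<and> kappa Q = kappa P \<longrightarrow>
          charpoly (matrix (G_op Q)) = charpoly (matrix (G_op P)) \<and>
          spectrum (matrix (G_op Q)) = spectrum (matrix (G_op P))) \<and>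
       S5 P = 1/3 - kappa P \<and>
       R5 P = 2/27 - 4/3 * kappa P \<and>
       R5 P = 4/3 * S5 P - 10/27 \<and>
       (kappa P < kappa_minus \<longrightarrow>
          (\<exists>a b c :: real. distinct [\<bar>a\<bar>, \<bar>b\<bar>, \<bar>c\<bar>] \<and>
             spectrum (matrix (G_op P)) = {#complex_of_real a, complex_of_real b, complex_of_real c#})) \<and>
       (kappa P = kappa_minus \<longrightarrow>
          (\<exists>a b :: real. a \<noteq> b \<and>
             spectrum (matrix (G_op P)) = {#complex_of_real a, complex_of_real b, complex_of_real b#})) \<and>
       (kappa_minus < kappa P \<and> kappa P < 0 \<longrightarrow>
          (\<exists>(a :: real) (z :: complex). Im z \<noteq> 0 \<and> cmod z < \<bar>a\<bar> \<and>
             spectrum (matrix (G_op P)) = {#complex_of_real a, z, cnj z#})) \<and>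
       (kappa P = 0 \<longrightarrow> spectrum (matrix (G_op P)) = {#1, 0, 0#}) \<and>
       (0 < kappa P \<and> kappa P < kappa_plus \<longrightarrow>
          (\<exists>a b c :: real. distinct [\<bar>a\<bar>, \<bar>b\<bar>, \<bar>c\<bar>] \<and>
             spectrum (matrix (G_op P)) = {#complex_of_real a, complex_of_real b, complex_of_real c#})) \<and>
       (kappa P = kappa_plus \<longrightarrow>
          (\<exists>a b :: real. a \<noteq> b \<and>
             spectrum (matrix (G_op P)) = {#complex_of_real a, complex_of_real b, complex_of_real b#})) \<and>
       (kappa_plus < kappa P \<longrightarrow>
          (\<exists>(a :: real) (z :: complex). Im z \<noteq> 0 \<and> \<bar>a\<bar> < cmod z \<and>
             spectrum (matrix (G_op P)) = {#complex_of_real a, z, cnj z#})) \<and>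
       (kappa P = kappa_minus \<longrightarrow>
          spectrum (matrix (G_op P)) =
            {#complex_of_real (2 + sqrt 5), complex_of_real (- golden), complex_of_real (- golden)#}) \<and>
       (kappa P = kappa_plus \<longrightarrow>
          spectrum (matrix (G_op P)) =
            {#complex_of_real (2 - sqrt 5), complex_of_real (inverse golden),
              complex_of_real (inverse golden)#})) \<and>
    (\<forall>x :: 5 \<Rightarrow> real^2. strictly_convex_pentagon x \<longrightarrow>
       (let P = affine_pt \<circ> x in
          glick_domain P \<and>
          kappa P \<le> kappa_minus \<and>
          (kappa P = kappa_minus \<longleftrightarrow> projectively_regular P) \<and>
          (\<forall>z \<in># spectrum (matrix (G_op P)). z \<in> \<real>) \<and>
          (\<not> projectively_regular P \<longrightarrow>
             (\<exists>a b c :: complex. distinct [cmod a, cmod b, cmod c] \<and>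
                spectrum (matrix (G_op P)) = {#a, b, c#}))))"
proof (intro conjI allI impI)
  fix P :: "5 \<Rightarrow> rp2"
  assume P: "glick_domain P"
  note spec = spectrum_G_op[OF P]
  show "kappa_den q \<noteq> 0" "kappa_num q / kappa_den q = kappa P" if "homogeneous_lift q P" for q
    using that P by (simp_all add: kappa_den_nonzero kappa_eq)
  show "glick_domain (f \<circ> P)" "kappa (f \<circ> P) = kappa P" if "projective_transformation f" for f
    using that P by (simp_all add: glick_domain_projective kappa_projective)
  show "glick_domain (relabel s P)" "kappa (relabel s P) = kappa P" for s
    using P by (simp_all add: glick_domain_relabel kappa_relabel)
  show "kappa P = - det (matrix (G_op P))"
    by (simp add: G_op_invariants(3)[OF P])
  show "charpoly (matrix (G_op P)) = [:kappa P, kappa P, -1, 1:]"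
    by (simp add: charpoly_G_op[OF P] glick_cubic_def)
  show "charpoly (matrix (G_op Q)) = charpoly (matrix (G_op P))"
    "spectrum (matrix (G_op Q)) = spectrum (matrix (G_op P))"
    if "glick_domain Q \<and> kappa Q = kappa P" for Q
    using that P by (simp_all add: charpoly_G_op spectrum_G_op)
  show "S5 P = 1/3 - kappa P" "R5 P = 2/27 - 4/3 * kappa P" "R5 P = 4/3 * S5 P - 10/27"
    by (simp_all add: S5_eq[OF P] R5_eq[OF P] field_simps)
  show "\<exists>a b c :: real. distinct [\<bar>a\<bar>, \<bar>b\<bar>, \<bar>c\<bar>] \<and>
      spectrum (matrix (G_op P)) = {#complex_of_real a, complex_of_real b, complex_of_real c#}"
    if "kappa P < kappa_minus"
    using glick_cubic_real_spectrum[of "kappa P"] that unfolding spec by metis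
  show "\<exists>a b c :: real. distinct [\<bar>a\<bar>, \<bar>b\<bar>, \<bar>c\<bar>] \<and>
      spectrum (matrix (G_op P)) = {#complex_of_real a, complex_of_real b, complex_of_real c#}"
    if "0 < kappa P \<and> kappa P < kappa_plus"
    using glick_cubic_real_spectrum[of "kappa P"] that unfolding spec by metis
  show "\<exists>(a :: real) (z :: complex). Im z \<noteq> 0 \<and> cmod z < \<bar>a\<bar> \<and>
      spectrum (matrix (G_op P)) = {#complex_of_real a, z, cnj z#}"
    if "kappa_minus < kappa P \<and> kappa P < 0"
    using glick_cubic_nonreal_spectrum[of "kappa P"] that unfolding spec by metis
  show "\<exists>(a :: real) (z :: complex). Im z \<noteq> 0 \<and> \<bar>a\<bar> < cmod z \<and>
      spectrum (matrix (G_op P)) = {#complex_of_real a, z, cnj z#}"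
    if "kappa_plus < kappa P"
    using glick_cubic_nonreal_spectrum[of "kappa P"] that kappa_plus_minus(3) unfolding spec
    by (metis order_less_trans)
  show "spectrum (matrix (G_op P)) = {#1, 0, 0#}" if "kappa P = 0"
    unfolding spec that by (rule glick_cubic_spectrum_0)
  show minus: "spectrum (matrix (G_op P)) =
      {#complex_of_real (2 + sqrt 5), complex_of_real (- golden), complex_of_real (- golden)#}"
    if "kappa P = kappa_minus"
    unfolding spec that by (rule glick_cubic_spectrum_kappa_minus)
  show plus: "spectrum (matrix (G_op P)) =
      {#complex_of_real (2 - sqrt 5), complex_of_real (inverse golden), complex_of_real (inverse golden)#}"
    if "kappa P = kappa_plus"
    unfolding spec that by (rule glick_cubic_spectrum_kappa_plus)
  \<comment> \<open>Makes \<open>2 - sqrt 5\<close> negative, which separates it from the positive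
    double root.\<close>
  have sqrt5: "2 < sqrt 5"
    by (rule real_less_rsqrt) simp
  have "- golden < 2 + sqrt 5"
    using sqrt5 by (simp add: golden_def field_simps)
  then have "2 + sqrt 5 \<noteq> - golden"
    by simp
  then show "\<exists>a b :: real. a \<noteq> b \<and>
      spectrum (matrix (G_op P)) = {#complex_of_real a, complex_of_real b, complex_of_real b#}"
    if "kappa P = kappa_minus"
    using minus[OF that] by blast
  have "2 - sqrt 5 < inverse golden"
    using sqrt5 unfolding inverse_golden by (simp add: field_simps)
  then have "2 - sqrt 5 \<noteq> inverse golden"
    by simp
  then show "\<exists>a b :: real. a \<noteq> b \<and>
      spectrum (matrix (G_op P)) = {#complex_of_real a, complex_of_real b, complex_of_real b#}"
    if "kappa P = kappa_plus"
    using plus[OF that] by blast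
next
  fix x :: "5 \<Rightarrow> real^2"
  assume "strictly_convex_pentagon x"
  then obtain q where q: "positively_oriented q" "homogeneous_lift q (affine_pt \<circ> x)"
    by (rule strictly_convex_pentagon_oriented)
  define P where "P = affine_pt \<circ> x"
  have P: "glick_domain P" and le: "kappa P \<le> kappa_minus"
    and regular: "kappa P = kappa_minus \<longleftrightarrow> projectively_regular P"
    using positively_oriented_glick_domain[OF q] positively_oriented_kappa_le[OF q]
      positively_oriented_regular_iff[OF q] by (simp_all add: P_def)
  have distinct: "\<exists>a b c :: real. distinct [\<bar>a\<bar>, \<bar>b\<bar>, \<bar>c\<bar>] \<and>
      spectrum (matrix (G_op P)) = {#complex_of_real a, complex_of_real b, complex_of_real c#}"
    if "kappa P < kappa_minus"
    using glick_cubic_real_spectrum[of "kappa P"] that unfolding spectrum_G_op[OF P] by metis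
  have "\<forall>z \<in># spectrum (matrix (G_op P)). z \<in> \<real>"
  proof (cases "kappa P = kappa_minus")
    case True
    then show ?thesis
      \<comment> \<open>Keeping each eigenvalue as a single \<open>of_real\<close> term exhibits it
        as real.\<close>
      by (simp add: spectrum_G_op[OF P] glick_cubic_spectrum_kappa_minus del: of_real_add of_real_minus)
  next
    case False
    then show ?thesis
      using distinct le by force
  qed
  moreover have "\<exists>a b c :: complex. distinct [cmod a, cmod b, cmod c] \<and>
      spectrum (matrix (G_op P)) = {#a, b, c#}" if "\<not> projectively_regular P"
  proof -
    have "kappa P < kappa_minus"
      using le regular that by (simp add: less_le)
    then obtain a b c :: real where abc: "distinct [\<bar>a\<bar>, \<bar>b\<bar>, \<bar>c\<bar>]"
      "spectrum (matrix (G_op P)) = {#complex_of_real a, complex_of_real b, complex_of_real c#}"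
      using distinct by blast
    then have "distinct [cmod (of_real a), cmod (of_real b), cmod (of_real c)]"
      by (simp only: norm_of_real)
    with abc(2) show ?thesis
      by blast
  qed
  ultimately show "let P = affine_pt \<circ> x in
      glick_domain P \<and>
      kappa P \<le> kappa_minus \<and>
      (kappa P = kappa_minus \<longleftrightarrow> projectively_regular P) \<and>
      (\<forall>z \<in># spectrum (matrix (G_op P)). z \<in> \<real>) \<and>
      (\<not> projectively_regular P \<longrightarrow>
         (\<exists>a b c :: complex. distinct [cmod a, cmod b, cmod c] \<and>
            spectrum (matrix (G_op P)) = {#a, b, c#}))"
    using P le regular unfolding Let_def P_def[symmetric] by blast
qed

end
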